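(* Let $b$ be a positive integer, $p$ an odd prime and $G$ a finite abelian group. Write $|G|=p^cm$ with $c\geq 0$ and $p\nmid m$, and suppose $m$ is not a perfect square. Let $q_1,\dots,q_s$ be the distinct prime divisors of $m$ and put $f=\gcd(\operatorname{ord}_p(q_1),\dots,\operatorname{ord}_p(q_s))$. If either a $\mathrm{BH}(G,p^b)$ matrix or a $\mathrm{BH}(G,2p^b)$ matrix exists, then: (i) $f$ is odd; (ii) either $f\leq m$ or $p\leq (f^2-m)/(f-m)$; (iii) $p\leq m^2+m+1$.
   Context: For a finite abelian group $(G,+)$ and a positive integer $h$, a $\mathrm{BH}(G,h)$ matrix is a $|G|\times|G|$ matrix $H=(a_{g,k})_{g,k\in G}$ whose entries are complex $h$th roots of unity, which is $G$-invariant (i.e. $a_{g+l,k+l}=a_{g,k}$ for all $g,k,l\in G$), and satisfies $HH^*=|G|I$. For a prime $q\neq p$, $\operatorname{ord}_p(q)$ is the least positive $j$ with $q^j\equiv1\pmod p$. *)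

theory Defs
  imports
    Complex_Main
    "HOL-Algebra.Coset"
    "HOL-Computational_Algebra.Nth_Powers"
    "HOL-Number_Theory.Number_Theory"
begin

(* A matrix with rows and columns indexed by G is a function on pairs of elements; only its
   values on the carrier matter. The group is written multiplicatively. *)
definition is_BH :: "('a, 'b) monoid_scheme \<Rightarrow> nat \<Rightarrow> ('a \<Rightarrow> 'a \<Rightarrow> complex) \<Rightarrow> bool" where
  "is_BH G h H \<longleftrightarrow>
     (\<forall>g\<in>carrier G. \<forall>k\<in>carrier G. H g k ^ h = 1) \<and>
     (\<forall>g\<in>carrier G. \<forall>k\<in>carrier G. \<forall>l\<in>carrier G.
        H (g \<otimes>\<^bsub>G\<^esub> l) (k \<otimes>\<^bsub>G\<^esub> l) = H g k) \<and>
     (\<forall>g\<in>carrier G. \<forall>k\<in>carrier G.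
        (\<Sum>l\<in>carrier G. H g l * cnj (H k l)) = (if g = k then of_nat (order G) else 0))"

end

theory Submission
  imports Defs "HOL-Computational_Algebra.Polynomial_Factorial"
begin

text \<open>
  Put \<open>n = p ^ b\<close>, and let \<open>\<zeta>\<close> be a primitive \<open>n\<close>-th root of unity. The row sum \<open>X\<close> of the matrix
  lies in \<open>\<int>[\<zeta>]\<close>, and \<open>|X|\<^sup>2\<close> is the product of \<open>m\<close> and a power of \<open>p\<close>. The only prime above \<open>p\<close>
  is \<open>1 - \<zeta>\<close>, and the product of \<open>1 - \<zeta> ^ k\<close> over half of the units has squared modulus \<open>p\<close>, so
  repeated division by it leaves \<open>x \<in> \<int>[\<zeta>]\<close> with \<open>|x|\<^sup>2 = m\<close>.

  Write \<open>x = \<Sum>i<n. c i * \<zeta> ^ i\<close>. Adding the squared moduli of all conjugates of \<open>x\<close> gives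
  \<open>\<Sum>\<^sub>C (p * \<Sum>\<^sub>C c\<^sup>2 - (\<Sum>\<^sub>C c)\<^sup>2) = (p - 1) * m\<close>, where \<open>C\<close> ranges over the cosets of the subgroup
  of order \<open>p\<close> of \<open>\<int>/n\<close>. The relations between the powers of \<open>\<zeta>\<close> say that \<open>c\<close> may be changed by a
  constant on each coset, so there is exactly one choice of \<open>c\<close> with \<open>|\<Sum>\<^sub>C c| < p / 2\<close> for all
  \<open>C\<close>. For this choice and \<open>m = 1\<close>, the identity forces \<open>x = \<plusminus>\<zeta> ^ i\<close>. For general \<open>m\<close> it gives
  (iii) by the counting argument for planar difference sets.

  For the rest, a prime \<open>q \<noteq> p\<close> is unramified: if \<open>q ^ a\<close> divides \<open>x * z\<close>, then it divides
  \<open>\<sigma> x * z\<close> for the Frobenius \<open>\<sigma>\<close> of \<open>q\<close>. If \<open>f\<close> is even, complex conjugation is a power of every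
  such \<open>\<sigma>\<close>, so every prime has even multiplicity in \<open>m\<close>, which proves (i). In general, the
  Frobenius maps of the prime divisors of \<open>m\<close> have a common power \<open>\<zeta> \<mapsto> \<zeta> ^ t\<close> of order \<open>f\<close>. It
  multiplies \<open>x\<close> by a root of unity, and \<open>x\<close> can be normalised to be fixed. By uniqueness \<open>c\<close> is
  then invariant under multiplication by \<open>t\<close>, which permutes the cosets other than the subgroup
  \<open>C\<^sub>0\<close> in orbits of length at least \<open>f\<close>. If \<open>f > m\<close>, only \<open>C\<^sub>0\<close> can contribute to the identity.
  The elements of \<open>C\<^sub>0 - {0}\<close> lie in orbits of length at least \<open>f\<close> as well, so the identity yields
  \<open>f * (p - f) \<le> (p - 1) * m\<close>, which is (ii), unless \<open>c\<close> is constant on \<open>C\<^sub>0 - {0}\<close>; but then \<open>m\<close>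
  would be a square.
\<close>

hide_const (open) Polynomial.order

section \<open>Evaluation of integer polynomials\<close>

definition ipoly :: "int poly \<Rightarrow> 'a :: comm_ring_1 \<Rightarrow> 'a" where
  "ipoly P z = poly (map_poly of_int P) z"

lemma ipoly_0 [simp]: "ipoly 0 z = 0"
  by (simp add: ipoly_def)

lemma ipoly_pCons [simp]: "ipoly (pCons a P) z = of_int a + z * ipoly P z"
  by (simp add: ipoly_def map_poly_pCons)

lemma ipoly_1 [simp]: "ipoly 1 z = 1"
  by (simp add: one_pCons)

lemma ipoly_add [simp]: "ipoly (P + Q) z = ipoly P z + ipoly Q z"
  by (induction P Q rule: poly_induct2) (simp_all add: algebra_simps)

lemma ipoly_smult [simp]: "ipoly (smult a P) z = of_int a * ipoly P z"
  by (induction P) (simp_all add: algebra_simps)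

lemma ipoly_minus [simp]: "ipoly (- P) z = - ipoly P z"
  using ipoly_smult[of "-1" P z] by simp

lemma ipoly_diff [simp]: "ipoly (P - Q) z = ipoly P z - ipoly Q z"
  using ipoly_add[of P "- Q" z] by simp

lemma ipoly_mult [simp]: "ipoly (P * Q) z = ipoly P z * ipoly Q z"
  by (induction P) (simp_all add: algebra_simps)

lemma ipoly_power [simp]: "ipoly (P ^ k) z = ipoly P z ^ k"
  by (induction k) simp_all

lemma ipoly_sum [simp]: "ipoly (\<Sum>i\<in>A. P i) z = (\<Sum>i\<in>A. ipoly (P i) z)"
  by (induction A rule: infinite_finite_induct) simp_all

lemma ipoly_of_nat [simp]: "ipoly (of_nat k) z = of_nat k"
  by (induction k) simp_all

lemma ipoly_monom [simp]: "ipoly (monom a k) z = of_int a * z ^ k"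
  by (induction k) (simp_all add: monom_0 monom_Suc algebra_simps)

lemma ipoly_pcompose_monom [simp]: "ipoly (P \<circ>\<^sub>p monom 1 k) z = ipoly P (z ^ k)"
  by (induction P) (simp_all add: pcompose_pCons)

lemma ipoly_at_1: "ipoly P 1 = of_int (poly P 1)"
  by (induction P) simp_all

lemma cnj_ipoly: "cnj (ipoly P z) = ipoly P (cnj z)"
  by (induction P) simp_all

definition int_adjoin :: "'a :: comm_ring_1 \<Rightarrow> 'a set" where
  "int_adjoin z = range (\<lambda>P. ipoly P z)"

lemma ipoly_in_int_adjoin [simp, intro]: "ipoly P z \<in> int_adjoin z"
  by (simp add: int_adjoin_def)

lemma int_adjoinE [elim?]:
  assumes "x \<in> int_adjoin z"
  obtains P where "x = ipoly P z"
  using assms by (auto simp: int_adjoin_def)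

lemma int_adjoin_generator [simp, intro]: "z \<in> int_adjoin z"
  using ipoly_in_int_adjoin[of "[:0, 1:]" z] by simp

lemma int_adjoin_of_int [simp, intro]: "of_int a \<in> int_adjoin z"
  using ipoly_in_int_adjoin[of "[:a:]" z] by simp

lemma int_adjoin_of_nat [simp, intro]: "of_nat k \<in> int_adjoin z"
  using ipoly_in_int_adjoin[of "of_nat k" z] by simp

lemma int_adjoin_0 [simp, intro]: "0 \<in> int_adjoin z"
  using int_adjoin_of_int[of 0 z] by simp

lemma int_adjoin_1 [simp, intro]: "1 \<in> int_adjoin z"
  using int_adjoin_of_int[of 1 z] by simp

lemma int_adjoin_add [simp, intro]: "x \<in> int_adjoin z \<Longrightarrow> y \<in> int_adjoin z \<Longrightarrow> x + y \<in> int_adjoin z"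
  by (auto elim!: int_adjoinE simp flip: ipoly_add)

lemma int_adjoin_mult [simp, intro]: "x \<in> int_adjoin z \<Longrightarrow> y \<in> int_adjoin z \<Longrightarrow> x * y \<in> int_adjoin z"
  by (auto elim!: int_adjoinE simp flip: ipoly_mult)

lemma int_adjoin_uminus [simp, intro]: "x \<in> int_adjoin z \<Longrightarrow> - x \<in> int_adjoin z"
  by (auto elim!: int_adjoinE simp flip: ipoly_minus)

lemma int_adjoin_diff [simp, intro]: "x \<in> int_adjoin z \<Longrightarrow> y \<in> int_adjoin z \<Longrightarrow> x - y \<in> int_adjoin z"
  using int_adjoin_add[of x z "- y"] by simp

lemma int_adjoin_power [simp, intro]: "x \<in> int_adjoin z \<Longrightarrow> x ^ k \<in> int_adjoin z"
  by (induction k) simp_all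

lemma int_adjoin_sum [simp, intro]: "(\<And>i. i \<in> A \<Longrightarrow> f i \<in> int_adjoin z) \<Longrightarrow> sum f A \<in> int_adjoin z"
  by (induction A rule: infinite_finite_induct) simp_all

lemma int_adjoin_prod [simp, intro]: "(\<And>i. i \<in> A \<Longrightarrow> f i \<in> int_adjoin z) \<Longrightarrow> prod f A \<in> int_adjoin z"
  by (induction A rule: infinite_finite_induct) simp_all

section \<open>Divisibility in a simple extension of the integers\<close>

definition adjoin_dvd :: "'a :: comm_ring_1 \<Rightarrow> 'a \<Rightarrow> 'a \<Rightarrow> bool" where
  "adjoin_dvd z x y \<longleftrightarrow> (\<exists>w\<in>int_adjoin z. y = x * w)"

lemma adjoin_dvdI [intro?]: "y = x * w \<Longrightarrow> w \<in> int_adjoin z \<Longrightarrow> adjoin_dvd z x y"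
  by (auto simp: adjoin_dvd_def)

lemma adjoin_dvdE [elim?]:
  assumes "adjoin_dvd z x y"
  obtains w where "w \<in> int_adjoin z" "y = x * w"
  using assms by (auto simp: adjoin_dvd_def)

lemma adjoin_dvd_triv_left [simp]: "w \<in> int_adjoin z \<Longrightarrow> adjoin_dvd z x (x * w)"
  by (auto simp: adjoin_dvd_def)

lemma adjoin_dvd_refl [simp]: "adjoin_dvd z x x"
  using adjoin_dvd_triv_left[of 1 z x] by simp

lemma adjoin_dvd_0 [simp]: "adjoin_dvd z x 0"
  using adjoin_dvd_triv_left[of 0 z x] by simp

lemma adjoin_dvd_trans: "adjoin_dvd z x y \<Longrightarrow> adjoin_dvd z y w \<Longrightarrow> adjoin_dvd z x w"
  by (auto simp: adjoin_dvd_def mult.assoc)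

lemma adjoin_dvd_mult_right:
  "adjoin_dvd z x y \<Longrightarrow> w \<in> int_adjoin z \<Longrightarrow> adjoin_dvd z x (y * w)"
  by (auto simp: adjoin_dvd_def mult.assoc)

lemma adjoin_dvd_mult_left:
  "adjoin_dvd z x y \<Longrightarrow> w \<in> int_adjoin z \<Longrightarrow> adjoin_dvd z x (w * y)"
  by (subst mult.commute) (rule adjoin_dvd_mult_right)

lemma adjoin_dvd_add: "adjoin_dvd z x y \<Longrightarrow> adjoin_dvd z x w \<Longrightarrow> adjoin_dvd z x (y + w)"
  by (auto simp: adjoin_dvd_def simp flip: distrib_left)

lemma adjoin_dvd_minus: "adjoin_dvd z x y \<Longrightarrow> adjoin_dvd z x (- y)"
  using adjoin_dvd_mult_left[of z x y "- 1"] by simp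

lemma adjoin_dvd_diff: "adjoin_dvd z x y \<Longrightarrow> adjoin_dvd z x w \<Longrightarrow> adjoin_dvd z x (y - w)"
  using adjoin_dvd_add[of z x y "- w"] adjoin_dvd_minus[of z x w] by simp

lemma adjoin_dvd_sum: "(\<And>i. i \<in> A \<Longrightarrow> adjoin_dvd z x (f i)) \<Longrightarrow> adjoin_dvd z x (sum f A)"
  by (induction A rule: infinite_finite_induct) (simp_all add: adjoin_dvd_add)

lemma adjoin_dvd_mult_mono:
  assumes "adjoin_dvd z v x" "adjoin_dvd z y w"
  shows "adjoin_dvd z (v * y) (x * w)"
proof -
  obtain s where s: "s \<in> int_adjoin z" "x = v * s" using assms(1) by (rule adjoin_dvdE)
  obtain t where t: "t \<in> int_adjoin z" "w = y * t" using assms(2) by (rule adjoin_dvdE)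
  have "x * w = (v * y) * (s * t)" using s t by (simp add: mult_ac)
  then show ?thesis by (rule adjoin_dvdI) (use s t in simp)
qed

lemma adjoin_dvd_prod_mono:
  "(\<And>i. i \<in> A \<Longrightarrow> adjoin_dvd z (f i) (g i)) \<Longrightarrow> adjoin_dvd z (prod f A) (prod g A)"
  by (induction A rule: infinite_finite_induct) (auto intro: adjoin_dvd_mult_mono)

lemma adjoin_dvd_power_diff:
  assumes "adjoin_dvd z a (x - y)" "x \<in> int_adjoin z" "y \<in> int_adjoin z"
  shows "adjoin_dvd z a (x ^ k - y ^ k)"
  unfolding power_diff_sumr2 using assms by (intro adjoin_dvd_mult_right) auto

lemma adjoin_dvd_power_mult:
  assumes "adjoin_dvd z a (x * w)" "x \<in> int_adjoin z" "k > 0"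
  shows "adjoin_dvd z a (x ^ k * w)"
proof -
  have "x ^ k * w = (x * w) * x ^ (k - 1)" using assms(3) by (cases k) (simp_all add: mult_ac)
  then show ?thesis using assms by (simp only: adjoin_dvd_mult_right int_adjoin_power)
qed

lemma le_imp_power_adjoin_dvd:
  assumes "x \<in> int_adjoin z" "j \<le> k"
  shows "adjoin_dvd z (x ^ j) (x ^ k)"
proof (rule adjoin_dvdI)
  show "x ^ k = x ^ j * x ^ (k - j)" using assms by (simp flip: power_add)
qed (use assms in simp)

lemma one_minus_power_adjoin_dvd: "x \<in> int_adjoin z \<Longrightarrow> adjoin_dvd z (1 - x) (1 - x ^ k)"
  by (simp add: one_diff_power_eq)

lemma adjoin_dvd_mult_cancel_left:
  fixes x :: "'a :: idom"
  shows "x \<noteq> 0 \<Longrightarrow> adjoin_dvd z (x * y) (x * w) \<longleftrightarrow> adjoin_dvd z y w"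
  by (auto simp: adjoin_dvd_def)

lemma of_nat_adjoin_dvd: "j dvd k \<Longrightarrow> adjoin_dvd z (of_nat j) (of_nat k)"
  by (auto elim!: dvdE)

lemma of_nat_adjoin_dvd_ipoly: "of_nat k dvd P \<Longrightarrow> adjoin_dvd z (of_nat k) (ipoly P z)"
  by (auto elim!: dvdE)

lemma of_nat_mult_adjoin_dvdI:
  assumes "adjoin_dvd z (of_nat j) x" "adjoin_dvd z (of_nat k) x" "coprime j k"
  shows "adjoin_dvd z (of_nat (j * k)) x"
proof -
  obtain y where y: "y \<in> int_adjoin z" "x = of_nat j * y" using assms(1) by (rule adjoin_dvdE)
  obtain w where w: "w \<in> int_adjoin z" "x = of_nat k * w" using assms(2) by (rule adjoin_dvdE)
  obtain u v where uv: "int j * u + int k * v = 1"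
    using assms(3) bezout_int[of "int j" "int k"] by (auto simp: mult.commute)
  have "x = of_int (int j * u + int k * v) * x" unfolding uv by simp
  also have "\<dots> = of_int u * of_nat j * x + of_int v * of_nat k * x"
    by (simp add: algebra_simps)
  also have "\<dots> = of_int u * of_nat j * (of_nat k * w) + of_int v * of_nat k * (of_nat j * y)"
    using y w by simp
  also have "\<dots> = of_nat (j * k) * (of_int u * w + of_int v * y)" by (simp add: algebra_simps)
  finally show ?thesis by (rule adjoin_dvdI) (use y w in simp)
qed

lemma of_nat_adjoin_dvd_if_prime_powers:
  assumes "m > 0" and x: "x \<in> int_adjoin z"
    and local: "\<And>q. q \<in> prime_factors m \<Longrightarrow> adjoin_dvd z (of_nat (q ^ multiplicity q m)) x"
  shows "adjoin_dvd z (of_nat m) x"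
proof -
  have "adjoin_dvd z (of_nat (\<Prod>q\<in>S. q ^ multiplicity q m)) x"
    if "finite S" "S \<subseteq> prime_factors m" for S
    using that
  proof (induction S rule: finite_induct)
    case empty
    show ?case using x by (simp add: adjoin_dvd_def)
  next
    case (insert q S)
    have "coprime (q ^ multiplicity q m) (\<Prod>r\<in>S. r ^ multiplicity r m)"
      using insert
      by (intro prod_coprime_right) (auto simp: in_prime_factors_iff intro!: primes_coprime)
    then show ?case
      unfolding prod.insert[OF insert.hyps]
      using insert by (intro of_nat_mult_adjoin_dvdI local) auto
  qed
  from this[of "prime_factors m"] show ?thesis
    using \<open>m > 0\<close> prime_factorization_nat[of m] by simp
qed

section \<open>Frobenius congruences\<close>

text \<open>
  Congruences in a commutative ring are written as divisibility of a difference, because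
  \<^const>\<open>cong\<close> requires a Euclidean semiring.
\<close>

lemma prime_dvd_binomial_defect:
  fixes a b :: "'a :: comm_ring_1"
  assumes "prime q"
  shows "of_nat q dvd (a + b) ^ q - (a ^ q + b ^ q)"
proof -
  have "q > 1" using assms by (rule prime_gt_1_nat)
  define g where "g k = of_nat (q choose k) * a ^ k * b ^ (q - k)" for k
  have "(a + b) ^ q = (\<Sum>k\<le>q. g k)"
    by (simp add: binomial_ring g_def)
  also have "{..q} = insert 0 (insert q {1..<q})" using \<open>q > 1\<close> by auto
  also have "(\<Sum>k\<in>\<dots>. g k) = b ^ q + a ^ q + (\<Sum>k=1..<q. g k)"
    using \<open>q > 1\<close> by (simp add: g_def)
  finally have "(a + b) ^ q - (a ^ q + b ^ q) = (\<Sum>k=1..<q. g k)" by simp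
  moreover have "of_nat q dvd g k" if "k \<in> {1..<q}" for k
  proof -
    have "q dvd (q choose k)" using that assms by (intro dvd_choose_prime) auto
    then show ?thesis by (auto simp: g_def)
  qed
  ultimately show ?thesis by (simp only: dvd_sum)
qed

lemma prime_dvd_power_minus_self:
  fixes a :: int
  assumes "prime q"
  shows "of_nat q dvd a ^ q - a"
proof (induction a rule: int_induct[where k = 0])
  case base
  show ?case using prime_gt_0_nat[OF assms] by (simp add: zero_power)
next
  case (step1 i)
  have "(i + 1) ^ q - (i + 1) = ((i + 1) ^ q - (i ^ q + 1 ^ q)) + (i ^ q - i)" by simp
  then show ?case using step1 prime_dvd_binomial_defect[OF assms, of i 1] by (simp only: dvd_add)
next
  case (step2 i)
  have "(i - 1) ^ q - (i - 1) = (i ^ q - i) - ((i - 1 + 1) ^ q - ((i - 1) ^ q + 1 ^ q))" by simp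
  then show ?case
    using step2 prime_dvd_binomial_defect[OF assms, of "i - 1" 1] by (simp only: dvd_diff)
qed

lemma dvd_power_diff: "d dvd a - b \<Longrightarrow> d dvd a ^ k - b ^ k" for a b d :: "'a :: comm_ring_1"
  by (metis dvd_mult2 power_diff_sumr2)

lemma prime_dvd_binomial_defect_iterated:
  fixes a b :: "'a :: comm_ring_1"
  assumes "prime q"
  shows "of_nat q dvd (a + b) ^ q ^ k - (a ^ q ^ k + b ^ q ^ k)"
proof (induction k)
  case (Suc k)
  define u v where "u = a ^ q ^ k" and "v = b ^ q ^ k"
  have "of_nat q dvd ((a + b) ^ q ^ k) ^ q - (u + v) ^ q"
    using Suc unfolding u_def v_def by (rule dvd_power_diff)
  moreover have "of_nat q dvd (u + v) ^ q - (u ^ q + v ^ q)"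
    using assms by (rule prime_dvd_binomial_defect)
  ultimately have "of_nat q dvd
      (((a + b) ^ q ^ k) ^ q - (u + v) ^ q) + ((u + v) ^ q - (u ^ q + v ^ q))"
    by (rule dvd_add)
  also have "\<dots> = (a + b) ^ q ^ Suc k - (a ^ q ^ Suc k + b ^ q ^ Suc k)"
    by (simp add: u_def v_def mult.commute[of q] flip: power_mult)
  finally show ?case .
qed simp

lemma prime_dvd_frobenius_poly:
  fixes P :: "int poly"
  assumes "prime q"
  shows "of_nat q dvd P ^ q - P \<circ>\<^sub>p monom 1 q"
proof (induction P)
  case 0
  show ?case using prime_gt_0_nat[OF assms] by (simp add: zero_power)
next
  case (pCons a P)
  define x where "x = monom (1::int) 1"
  have P: "pCons a P = [:a:] + x * P"
    by (simp add: x_def monom_Suc monom_0)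
  have comp: "pCons a P \<circ>\<^sub>p monom 1 q = [:a:] + x ^ q * (P \<circ>\<^sub>p monom 1 q)"
    by (simp add: pcompose_pCons x_def monom_power)
  have "of_nat q dvd [:a:] ^ q - [:a:]"
    using prime_dvd_power_minus_self[OF assms, of a]
    by (simp add: poly_const_pow of_nat_poly const_poly_dvd_const_poly_iff)
  moreover have "of_nat q dvd x ^ q * (P ^ q - P \<circ>\<^sub>p monom 1 q)"
    using pCons.IH by (rule dvd_mult)
  moreover have "of_nat q dvd ([:a:] + x * P) ^ q - ([:a:] ^ q + (x * P) ^ q)"
    using assms by (rule prime_dvd_binomial_defect)
  ultimately have "of_nat q dvd (([:a:] + x * P) ^ q - ([:a:] ^ q + (x * P) ^ q))
     + ([:a:] ^ q - [:a:]) + x ^ q * (P ^ q - P \<circ>\<^sub>p monom 1 q)"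
    by (intro dvd_add)
  also have "\<dots> = pCons a P ^ q - pCons a P \<circ>\<^sub>p monom 1 q"
    unfolding comp unfolding P by (simp add: algebra_simps)
  finally show ?case .
qed

lemma power_prime_power_cong:
  fixes a b :: "'a :: comm_ring_1"
  assumes "of_nat q dvd a - b"
  shows "of_nat (q ^ Suc k) dvd a ^ q ^ k - b ^ q ^ k"
proof (induction k)
  case 0
  show ?case using assms by simp
next
  case (Suc k)
  define x y where "x = a ^ q ^ k" and "y = b ^ q ^ k"
  have "of_nat q dvd x - y" unfolding x_def y_def using assms by (rule dvd_power_diff)
  then have "of_nat q dvd (\<Sum>i<q. y ^ (q - Suc i) * (x ^ i - y ^ i)) + of_nat q * y ^ (q - 1)"
    by (intro dvd_add dvd_sum dvd_mult dvd_power_diff dvd_triv_left)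
  also have "\<dots> = (\<Sum>i<q. y ^ (q - Suc i) * (x ^ i - y ^ i) + y ^ (q - 1))"
    by (simp add: sum.distrib)
  also have "\<dots> = (\<Sum>i<q. y ^ (q - Suc i) * x ^ i)"
    by (intro sum.cong) (auto simp: right_diff_distrib simp flip: power_add)
  finally have "of_nat (q ^ Suc k) * of_nat q dvd (x - y) * (\<Sum>i<q. y ^ (q - Suc i) * x ^ i)"
    using Suc unfolding x_def y_def by (rule mult_dvd_mono[rotated])
  also have "\<dots> = a ^ q ^ Suc k - b ^ q ^ Suc k"
    unfolding power_diff_sumr2[symmetric] x_def y_def
    by (simp add: mult.commute[of q] flip: power_mult)
  finally show ?case by (simp add: mult_ac)
qed

lemma adjoin_dvd_power_prime_power:
  assumes "adjoin_dvd z (of_nat q) (x - y)" "y \<in> int_adjoin z"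
  shows "adjoin_dvd z (of_nat (q ^ Suc k)) (x ^ q ^ k - y ^ q ^ k)"
proof -
  obtain w where w: "w \<in> int_adjoin z" "x - y = of_nat q * w" using assms(1) by (rule adjoin_dvdE)
  obtain W where W: "w = ipoly W z" using w(1) by (rule int_adjoinE)
  obtain Y where Y: "y = ipoly Y z" using assms(2) by (rule int_adjoinE)
  have "of_nat (q ^ Suc k) dvd (Y + of_nat q * W) ^ q ^ k - Y ^ q ^ k"
    by (rule power_prime_power_cong) simp
  from of_nat_adjoin_dvd_ipoly[OF this, of z] show ?thesis
    using w(2) by (simp add: Y W algebra_simps)
qed

section \<open>Irreducible polynomials\<close>

lemma pcompose_monom: "monom (1 :: 'a :: comm_ring_1) k \<circ>\<^sub>p Q = Q ^ k"
  by (induction k) (simp_all add: monom_0 monom_Suc pcompose_pCons pcompose_const)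

lemma eisenstein_cofactor_const:
  fixes g h :: "'a :: idom poly"
  assumes p: "prime_elem p" and h: "\<not> p dvd coeff h 0"
    and lower: "\<And>i. i < degree (g * h) \<Longrightarrow> p dvd coeff (g * h) i"
    and lead: "\<not> p dvd lead_coeff (g * h)"
  shows "degree h = 0"
proof -
  have "g \<noteq> 0" "h \<noteq> 0" and g: "\<not> p dvd lead_coeff g" using lead by (auto simp: lead_coeff_mult)
  define i where "i = (LEAST i. \<not> p dvd coeff g i)"
  have i: "\<not> p dvd coeff g i" "i \<le> degree g"
    unfolding i_def using g by (rule LeastI, rule Least_le)
  have below: "p dvd coeff g j" if "j < i" for j
    using not_less_Least that unfolding i_def by blast
  have "coeff (g * h) i = (\<Sum>j<i. coeff g j * coeff h (i - j)) + coeff g i * coeff h 0"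
    by (simp add: coeff_mult lessThan_Suc_atMost[symmetric])
  moreover have "p dvd (\<Sum>j<i. coeff g j * coeff h (i - j))" using below by (intro dvd_sum) auto
  moreover have "\<not> p dvd coeff g i * coeff h 0" using i h p by (simp add: prime_elem_dvd_mult_iff)
  ultimately have "\<not> p dvd coeff (g * h) i" by (simp add: dvd_add_right_iff)
  then have "degree (g * h) \<le> i" using lower not_le by blast
  then show ?thesis using i \<open>g \<noteq> 0\<close> \<open>h \<noteq> 0\<close> by (simp add: degree_mult_eq)
qed

theorem eisenstein_irreducible:
  fixes f :: "'a :: idom poly"
  assumes p: "prime_elem p" and monic: "lead_coeff f = 1" and deg: "degree f > 0"
    and lower: "\<And>i. i < degree f \<Longrightarrow> p dvd coeff f i" and const: "\<not> p\<^sup>2 dvd coeff f 0"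
  shows "irreducible f"
proof (rule irreducibleI)
  show "f \<noteq> 0" "\<not> f dvd 1" using deg by (auto simp: is_unit_poly_iff)
  fix g h assume f: "f = g * h"
  have unit: "\<not> p dvd lead_coeff f" using p monic by (simp add: prime_elem_def)
  have "lead_coeff g * lead_coeff h = 1" using monic by (simp add: f lead_coeff_mult)
  then have units: "lead_coeff g dvd 1" "lead_coeff h dvd 1"
    by (metis dvd_triv_left dvd_triv_right)+
  have "\<not> (p dvd coeff g 0 \<and> p dvd coeff h 0)"
    using const by (auto simp: f coeff_mult_0 power2_eq_square intro: mult_dvd_mono)
  then have "degree g = 0 \<or> degree h = 0"
    using eisenstein_cofactor_const[OF p, of h g] eisenstein_cofactor_const[OF p, of g h] lower unit
    by (auto simp: f mult.commute)
  then show "g dvd 1 \<or> h dvd 1" using units by (auto simp: is_unit_poly_iff elim!: degree_eq_zeroE)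
qed

lemma irreducible_if_pcompose_shift_irreducible:
  fixes f :: "'a :: idom poly"
  assumes "irreducible (f \<circ>\<^sub>p [:a, 1:])"
  shows "irreducible f"
proof (rule irreducibleI)
  have unit: "g dvd 1" if shifted: "g \<circ>\<^sub>p [:a, 1:] dvd 1" for g
  proof -
    obtain u where "1 = (g \<circ>\<^sub>p [:a, 1:]) * u" using shifted by (rule dvdE)
    then have "1 \<circ>\<^sub>p [:-a, 1:] = ((g \<circ>\<^sub>p [:a, 1:]) * u) \<circ>\<^sub>p [:-a, 1:]" by simp
    then have "1 = (g \<circ>\<^sub>p [:0, 1:]) * (u \<circ>\<^sub>p [:-a, 1:])"
      by (simp add: pcompose_1 pcompose_mult pcompose_assoc[symmetric] pcompose_pCons)
    then show ?thesis by (metis dvd_triv_left pcompose_idR)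
  qed
  show "f \<noteq> 0" using assms by auto
  show "\<not> f dvd 1"
  proof
    assume "f dvd 1"
    then obtain u where "1 = f * u" by blast
    then have "1 = (f \<circ>\<^sub>p [:a, 1:]) * (u \<circ>\<^sub>p [:a, 1:])" by (metis pcompose_1 pcompose_mult)
    then show False using assms irreducible_not_unit by (metis dvd_triv_left)
  qed
  show "g dvd 1 \<or> h dvd 1" if "f = g * h" for g h
    using irreducibleD[OF assms, of "g \<circ>\<^sub>p [:a, 1:]" "h \<circ>\<^sub>p [:a, 1:]"] that unit
    by (auto simp: pcompose_mult)
qed

lemma ex_min_degree_root_poly:
  fixes Q :: "int poly" and z :: "'a :: {idom, ring_char_0}"
  assumes "Q \<noteq> 0" "ipoly Q z = 0"
  obtains U where "U \<noteq> 0" "ipoly U z = 0" "\<And>V. ipoly V z = 0 \<Longrightarrow> \<exists>a. a \<noteq> 0 \<and> U dvd [:a:] * V"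
proof -
  obtain U where U: "U \<noteq> 0" "ipoly U z = 0"
    and minimal: "\<And>V. V \<noteq> 0 \<Longrightarrow> ipoly V z = 0 \<Longrightarrow> degree U \<le> degree V"
    using ex_has_least_nat[of "\<lambda>V. V \<noteq> 0 \<and> ipoly V z = 0" Q degree] assms by blast
  have "\<exists>a. a \<noteq> 0 \<and> U dvd [:a:] * V" if "ipoly V z = 0" for V
  proof -
    obtain a S where S: "a \<noteq> 0" "smult a V = U * S + pseudo_mod V U"
      using pseudo_mod(1)[OF U(1)] by blast
    then have "ipoly (pseudo_mod V U) z = ipoly (smult a V - U * S) z" by simp
    then have "ipoly (pseudo_mod V U) z = 0" using U that by simp
    then have "pseudo_mod V U = 0"
      using pseudo_mod(2)[OF U(1), of V] minimal[of "pseudo_mod V U"] by linarith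
    then show ?thesis using S by auto
  qed
  then show ?thesis using U that by blast
qed

lemma irreducible_dvd_if_common_root:
  fixes P Q :: "int poly" and z :: "'a :: {idom, ring_char_0}"
  assumes Q: "irreducible Q" "ipoly Q z = 0" and P: "ipoly P z = 0"
  shows "Q dvd P"
proof -
  have "Q \<noteq> 0" using Q by auto
  then obtain U where U: "U \<noteq> 0" "ipoly U z = 0"
    and U_dvd: "\<And>V. ipoly V z = 0 \<Longrightarrow> \<exists>a. a \<noteq> 0 \<and> U dvd [:a:] * V"
    using ex_min_degree_root_poly Q(2) by blast
  have prime: "prime_elem Q" using Q(1) by (rule irreducible_imp_prime_poly)
  have no_const: "ipoly [:a:] z \<noteq> 0" if "a \<noteq> 0" for a using that by simp
  obtain a S where S: "a \<noteq> 0" "[:a:] * Q = U * S" using U_dvd[OF Q(2)] by blast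
  have "\<not> Q dvd S"
  proof
    assume "Q dvd S"
    then obtain T where "S = Q * T" by (rule dvdE)
    with S have "Q * [:a:] = Q * (U * T)" by (simp only: mult_ac)
    then have "[:a:] = U * T" using \<open>Q \<noteq> 0\<close> mult_left_cancel by blast
    then show False using U(2) no_const[OF S(1)] by simp
  qed
  moreover have "Q dvd U * S" unfolding S(2)[symmetric] by (rule dvd_triv_right)
  ultimately have "Q dvd U" using prime by (simp add: prime_elem_dvd_mult_iff)
  moreover obtain b where b: "b \<noteq> 0" "U dvd [:b:] * P" using U_dvd[OF P] by blast
  ultimately have "Q dvd [:b:] * P" using dvd_trans by blast
  moreover have "\<not> Q dvd [:b:]"
    using Q(2) no_const[OF b(1)] by (metis dvdE ipoly_mult mult_zero_left)
  ultimately show ?thesis using prime by (simp only: prime_elem_dvd_mult_iff) simp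
qed

section \<open>Primitive roots of unity\<close>

definition primitive_root_of_unity :: "nat \<Rightarrow> 'a :: monoid_mult \<Rightarrow> bool" where
  "primitive_root_of_unity n z \<longleftrightarrow> (\<forall>k. z ^ k = 1 \<longleftrightarrow> n dvd k)"

lemma primitive_root_of_unity_power:
  assumes "primitive_root_of_unity (m * n) z" "m > 0"
  shows "primitive_root_of_unity n (z ^ m)"
  using assms by (simp add: primitive_root_of_unity_def flip: power_mult)

lemma primitive_root_of_unity_power_mod:
  assumes "primitive_root_of_unity n z"
  shows "z ^ (k mod n) = z ^ k"
proof -
  have "z ^ n = 1" using assms by (simp add: primitive_root_of_unity_def)
  have "z ^ k = z ^ (n * (k div n) + k mod n)" by simp
  also have "\<dots> = z ^ (k mod n)" by (simp only: power_add power_mult \<open>z ^ n = 1\<close>) simp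
  finally show ?thesis by simp
qed

lemma primitive_root_of_unity_power_eq_iff:
  fixes z :: "'a :: field"
  assumes z: "primitive_root_of_unity n z" and n: "n > 0"
  shows "z ^ j = z ^ k \<longleftrightarrow> [j = k] (mod n)"
proof
  show "z ^ j = z ^ k" if "[j = k] (mod n)"
    using that primitive_root_of_unity_power_mod[OF z] by (metis cong_def)
  have "z ^ n = 1" using z by (simp add: primitive_root_of_unity_def)
  then have "z \<noteq> 0" using n by (auto simp: power_0_left)
  show "[j = k] (mod n)" if "z ^ j = z ^ k"
    using that
  proof (induction j k rule: linorder_wlog)
    case (le j k)
    have "z ^ j * z ^ (k - j) = z ^ k" using le(1) by (simp flip: power_add)
    then have "z ^ (k - j) = 1" using le(2) \<open>z \<noteq> 0\<close> by simp
    then have "n dvd k - j" using z by (simp add: primitive_root_of_unity_def)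
    then have "[k = j] (mod n)" using le(1) by (simp add: cong_altdef_nat)
    then show ?case by (rule cong_sym)
  qed (simp add: cong_sym_eq)
qed

lemma primitive_root_of_unity_cis:
  assumes "n > 0"
  shows "primitive_root_of_unity n (cis (2 * pi / real n))"
  unfolding primitive_root_of_unity_def
proof (intro allI iffI)
  let ?z = "cis (2 * pi / real n)"
  have one: "?z ^ n = 1" using assms by (simp add: DeMoivre)
  fix k
  show "?z ^ k = 1" if "n dvd k" using that one by (auto simp: power_mult)
  assume "?z ^ k = 1"
  then have "?z ^ (k mod n) * (?z ^ n) ^ (k div n) = 1" by (simp flip: power_mult power_add)
  then have "cis (2 * pi * real (k mod n) / real n) = cis (2 * pi * real 0 / real n)"
    unfolding one by (simp add: DeMoivre mult.commute)
  then have "k mod n = 0"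
    using bij_betw_roots_unity[OF assms] assms
    by (meson bij_betw_def inj_onD lessThan_iff mod_less_divisor)
  then show "n dvd k" by auto
qed

lemma root_of_unity_mult_cnj:
  fixes z :: complex
  assumes "z ^ n = 1" "n > 0"
  shows "z * cnj z = 1"
  using power_eq_1_iff[OF assms(1)] assms(2) by (simp add: complex_norm_square[symmetric])

lemma orthogonality_roots_of_unity:
  fixes z :: complex
  assumes z: "primitive_root_of_unity n z" and "i < n" "j < n"
  shows "(\<Sum>k<n. (z ^ i * cnj z ^ j) ^ k) = (if i = j then of_nat n else 0)"
proof -
  have "n > 0" using assms by simp
  have zn: "z ^ n = 1" using z by (simp add: primitive_root_of_unity_def)
  have inv: "z ^ k * cnj z ^ k = 1" for k
    using root_of_unity_mult_cnj[OF zn \<open>n > 0\<close>] by (simp flip: power_mult_distrib)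
  show ?thesis
  proof (cases "i = j")
    case False
    have "z ^ i * cnj z ^ j \<noteq> 1"
    proof
      assume "z ^ i * cnj z ^ j = 1"
      then have "z ^ i * (z ^ j * cnj z ^ j) = z ^ j"
        by (metis mult.left_commute mult.right_neutral)
      then have "[i = j] (mod n)"
        by (simp add: inv primitive_root_of_unity_power_eq_iff[OF z \<open>n > 0\<close>])
      then show False using assms False by (simp add: cong_def)
    qed
    moreover have "(z ^ i * cnj z ^ j) ^ n = (z ^ n) ^ i * cnj (z ^ n) ^ j"
      unfolding power_mult_distrib complex_cnj_power power_mult[symmetric]
      by (simp only: mult.commute)
    ultimately show ?thesis using False by (simp add: geometric_sum zn)
  qed (simp add: inv)
qed

lemma parseval_roots_of_unity:
  fixes z :: complex and f :: "nat \<Rightarrow> complex"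
  assumes z: "primitive_root_of_unity n z"
  shows "(\<Sum>k<n. (\<Sum>i<n. f i * z ^ (i * k)) * cnj (\<Sum>i<n. f i * z ^ (i * k))) =
     of_nat n * (\<Sum>i<n. f i * cnj (f i))"
proof -
  have "(\<Sum>k<n. (\<Sum>i<n. f i * z ^ (i * k)) * cnj (\<Sum>i<n. f i * z ^ (i * k)))
      = (\<Sum>k<n. \<Sum>i<n. \<Sum>j<n. f i * cnj (f j) * (z ^ i * cnj z ^ j) ^ k)"
    by (simp add: sum_product power_mult_distrib mult_ac flip: power_mult)
  also have "\<dots> = (\<Sum>i<n. \<Sum>j<n. \<Sum>k<n. f i * cnj (f j) * (z ^ i * cnj z ^ j) ^ k)"
    by (subst sum.swap) (intro sum.cong refl sum.swap)
  also have "\<dots> = (\<Sum>i<n. \<Sum>j<n. if i = j then of_nat n * (f i * cnj (f j)) else 0)"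
    by (intro sum.cong refl)
      (auto simp: orthogonality_roots_of_unity[OF z] simp flip: sum_distrib_left)
  also have "\<dots> = of_nat n * (\<Sum>i<n. f i * cnj (f i))"
    by (simp add: sum_distrib_left)
  finally show ?thesis .
qed

section \<open>Sums of squared differences\<close>

definition spread :: "('a \<Rightarrow> int) \<Rightarrow> 'a set \<Rightarrow> int" where
  "spread c A = int (card A) * (\<Sum>i\<in>A. (c i)\<^sup>2) - (\<Sum>i\<in>A. c i)\<^sup>2"

lemma spread_eq_sum_diff_squares: "2 * spread c A = (\<Sum>i\<in>A. \<Sum>j\<in>A. (c i - c j)\<^sup>2)"
proof -
  have "(\<Sum>i\<in>A. \<Sum>j\<in>A. (c i - c j)\<^sup>2) = (\<Sum>i\<in>A. \<Sum>j\<in>A. (c i)\<^sup>2 + (c j)\<^sup>2 - 2 * (c i * c j))"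
    by (intro sum.cong refl) (simp add: power2_diff)
  also have "\<dots> = 2 * spread c A"
    by (simp add: sum_subtractf sum.distrib sum_distrib_left[symmetric] sum_distrib_right[symmetric]
        spread_def power2_eq_square)
  finally show ?thesis by simp
qed

lemma spread_nonneg: "spread c A \<ge> 0"
proof -
  have "2 * spread c A \<ge> 0" unfolding spread_eq_sum_diff_squares by (intro sum_nonneg) auto
  then show ?thesis by simp
qed

lemma spread_shift: "spread (\<lambda>i. c i - v) A = spread c A"
  using spread_eq_sum_diff_squares[of "\<lambda>i. c i - v" A] spread_eq_sum_diff_squares[of c A] by simp

lemma spread_reindex:
  assumes "bij_betw h A B"
  shows "spread c B = spread (\<lambda>i. c (h i)) A"
  unfolding spread_def
  by (simp add: bij_betw_same_card[OF assms] flip: sum.reindex_bij_betw[OF assms])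

lemma spread_eq_0_iff:
  assumes "finite A"
  shows "spread c A = 0 \<longleftrightarrow> (\<forall>i\<in>A. \<forall>j\<in>A. c i = c j)"
proof -
  have "spread c A = 0 \<longleftrightarrow> (\<Sum>i\<in>A. \<Sum>j\<in>A. (c i - c j)\<^sup>2) = 0"
    by (simp flip: spread_eq_sum_diff_squares)
  also have "\<dots> \<longleftrightarrow> (\<forall>i\<in>A. (\<Sum>j\<in>A. (c i - c j)\<^sup>2) = 0)"
    by (intro sum_nonneg_eq_0_iff assms sum_nonneg) simp
  also have "\<dots> \<longleftrightarrow> (\<forall>i\<in>A. \<forall>j\<in>A. (c i - c j)\<^sup>2 = 0)"
    by (intro ball_cong refl sum_nonneg_eq_0_iff assms) simp
  finally show ?thesis by simp
qed

lemma spread_ge_value_class: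
  fixes c :: "'a \<Rightarrow> int" and v :: int
  assumes "finite A"
  defines "s \<equiv> int (card {i \<in> A. c i = v})"
  shows "s * (int (card A) - s) \<le> spread c A"
proof -
  define S T where "S = {i \<in> A. c i = v}" and "T = A - S"
  have fin: "finite S" "finite T" and sub: "S \<subseteq> A" using assms by (auto simp: S_def T_def)
  have T: "int (card T) = int (card A) - s"
    using fin sub \<open>finite A\<close> by (simp add: T_def s_def S_def card_Diff_subset of_nat_diff card_mono)
  have "2 * (s * (int (card A) - s)) = int (card (S \<times> T \<union> T \<times> S))"
    unfolding T[symmetric] using fin
    by (subst card_Un_disjoint) (auto simp: card_cartesian_product s_def S_def T_def)
  also have "\<dots> = (\<Sum>(i, j)\<in>S \<times> T \<union> T \<times> S. 1)" by simp
  also have "\<dots> \<le> (\<Sum>(i, j)\<in>S \<times> T \<union> T \<times> S. (c i - c j)\<^sup>2)"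
  proof (intro sum_mono)
    fix ij assume "ij \<in> S \<times> T \<union> T \<times> S"
    moreover obtain i j where ij: "ij = (i, j)" by (rule prod.exhaust)
    ultimately have "c i - c j \<noteq> 0" by (auto simp: S_def T_def)
    then have "1 \<le> (c i - c j)\<^sup>2" using zero_less_power2[of "c i - c j"] by linarith
    then show "(case ij of (i, j) \<Rightarrow> 1) \<le> (case ij of (i, j) \<Rightarrow> (c i - c j)\<^sup>2)"
      unfolding ij by simp
  qed
  also have "\<dots> \<le> (\<Sum>(i, j)\<in>A \<times> A. (c i - c j)\<^sup>2)"
    using sub \<open>finite A\<close> by (intro sum_mono2) (auto simp: T_def)
  also have "\<dots> = 2 * spread c A"
    by (simp add: spread_eq_sum_diff_squares sum.cartesian_product)
  finally show ?thesis by simp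
qed

lemma mult_diff_mono:
  fixes a s m :: int
  assumes "a \<le> s" "s \<le> m - a"
  shows "a * (m - a) \<le> s * (m - s)"
proof -
  have "s * (m - s) - a * (m - a) = (s - a) * (m - a - s)" by (simp add: algebra_simps)
  then show ?thesis using assms by (smt (verit) mult_nonneg_nonneg)
qed

lemma spread_ge_two_classes:
  assumes fin: "finite A" and ne: "c i \<noteq> c j"
    and card: "f \<le> card {x \<in> A. c x = c i}" "f \<le> card {x \<in> A. c x = c j}"
  shows "int f * (int (card A) - int f) \<le> spread c A"
proof -
  have "card {x \<in> A. c x = c i} + card {x \<in> A. c x = c j} =
      card ({x \<in> A. c x = c i} \<union> {x \<in> A. c x = c j})"
    using fin ne by (subst card_Un_disjoint) auto
  also have "\<dots> \<le> card A" using fin by (intro card_mono) auto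
  finally have "int f * (int (card A) - int f) \<le>
      int (card {x \<in> A. c x = c i}) * (int (card A) - int (card {x \<in> A. c x = c i}))"
    using card by (intro mult_diff_mono) auto
  also have "\<dots> \<le> spread c A" using fin by (rule spread_ge_value_class)
  finally show ?thesis .
qed

lemma spread_ge_card_minus_1:
  assumes fin: "finite A" and "spread c A \<noteq> 0"
  shows "int (card A) - 1 \<le> spread c A"
proof -
  obtain i j where ij: "i \<in> A" "j \<in> A" "c i \<noteq> c j"
    using assms spread_eq_0_iff by metis
  have "1 \<le> card {x \<in> A. c x = c k}" if "k \<in> A" for k
    using that fin by (auto simp: Suc_le_eq card_gt_0_iff)
  then show ?thesis using spread_ge_two_classes[OF fin ij(3), of 1] ij by simp
qed

lemma spread_one_off:
  assumes fin: "finite A" and "i \<in> A" and v: "\<And>j. j \<in> A - {i} \<Longrightarrow> c j = v"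
  shows "spread c A = (int (card A) - 1) * (c i - v)\<^sup>2"
proof -
  have "(\<Sum>j\<in>A. (c j - v)\<^sup>2) = (c i - v)\<^sup>2" "(\<Sum>j\<in>A. c j - v) = c i - v"
    using assms by (simp_all add: sum.remove)
  then have "spread (\<lambda>i. c i - v) A = (int (card A) - 1) * (c i - v)\<^sup>2"
    unfolding spread_def by (simp only: left_diff_distrib mult_1)
  then show ?thesis by (simp only: spread_shift)
qed

lemma abs_le_square: "\<bar>x\<bar> \<le> x\<^sup>2" for x :: int
  using self_le_power[of "\<bar>x\<bar>" 2] by (cases "x = 0") auto

lemma abs_sum_le_sum_squares: "\<bar>\<Sum>i\<in>A. c i\<bar> \<le> (\<Sum>i\<in>A. (c i)\<^sup>2)" for c :: "'a \<Rightarrow> int"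
proof -
  have "\<bar>\<Sum>i\<in>A. c i\<bar> \<le> (\<Sum>i\<in>A. \<bar>c i\<bar>)" by (rule sum_abs)
  also have "\<dots> \<le> (\<Sum>i\<in>A. (c i)\<^sup>2)" by (intro sum_mono abs_le_square)
  finally show ?thesis .
qed

lemma spread_ge_abs_sum:
  fixes c :: "'a \<Rightarrow> int"
  assumes "2 * \<bar>\<Sum>i\<in>A. c i\<bar> < int (card A)"
  shows "(int (card A) + 1) * \<bar>\<Sum>i\<in>A. c i\<bar> \<le> 2 * spread c A"
proof -
  define s where "s = \<bar>\<Sum>i\<in>A. c i\<bar>"
  have "s * (2 * s) \<le> s * (int (card A) - 1)"
    using assms by (intro mult_left_mono) (auto simp: s_def)
  moreover have "int (card A) * s \<le> int (card A) * (\<Sum>i\<in>A. (c i)\<^sup>2)"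
    unfolding s_def by (intro mult_left_mono abs_sum_le_sum_squares) simp
  moreover have "s * s = (\<Sum>i\<in>A. c i)\<^sup>2" by (simp add: s_def power2_eq_square)
  ultimately show ?thesis unfolding s_def[symmetric] spread_def by (simp add: algebra_simps)
qed

lemma sum_squares_le_square_sum_abs:
  fixes s :: "'a \<Rightarrow> int"
  assumes "finite A"
  shows "(\<Sum>i\<in>A. (s i)\<^sup>2) \<le> (\<Sum>i\<in>A. \<bar>s i\<bar>)\<^sup>2"
  using assms
proof (induction A rule: finite_induct)
  case (insert x A)
  have "0 \<le> \<bar>s x\<bar> * (\<Sum>i\<in>A. \<bar>s i\<bar>)" by (intro mult_nonneg_nonneg sum_nonneg) auto
  then have "(s x)\<^sup>2 + (\<Sum>i\<in>A. (s i)\<^sup>2) \<le> (\<bar>s x\<bar> + (\<Sum>i\<in>A. \<bar>s i\<bar>))\<^sup>2"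
    using insert.IH unfolding power2_sum power2_abs mult.assoc by linarith
  then show ?case using insert.hyps by simp
qed simp

lemma sum_squares_eq_1_imp_single:
  fixes c :: "'a \<Rightarrow> int"
  assumes fin: "finite A" and sum: "(\<Sum>i\<in>A. (c i)\<^sup>2) = 1"
  obtains i where "i \<in> A" "\<bar>c i\<bar> = 1" "\<And>j. j \<in> A - {i} \<Longrightarrow> c j = 0"
proof -
  obtain i where i: "i \<in> A" "c i \<noteq> 0"
    using sum by (metis (no_types, lifting) sum.neutral zero_neq_one zero_power2)
  have split: "(c i)\<^sup>2 + (\<Sum>j\<in>A - {i}. (c j)\<^sup>2) = 1"
    using sum i(1) fin by (simp add: sum.remove)
  have "(c i)\<^sup>2 > 0" using i(2) by simp
  moreover have nonneg: "(\<Sum>j\<in>A - {i}. (c j)\<^sup>2) \<ge> 0" by (intro sum_nonneg) simp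
  ultimately have "(c i)\<^sup>2 = 1" "(\<Sum>j\<in>A - {i}. (c j)\<^sup>2) = 0" using split by linarith+
  then show ?thesis using that[OF i(1)] fin by (auto simp: sum_nonneg_eq_0_iff power2_eq_1_iff)
qed

lemma ex_balancing_shift:
  fixes p s :: int
  assumes "odd p" "p > 0"
  obtains v where "2 * \<bar>s - p * v\<bar> < p"
proof -
  obtain h where h: "p = 2 * h + 1" using \<open>odd p\<close> by (rule oddE)
  define r where "r = (s + h) mod p"
  have "0 \<le> r" "r < p" using \<open>p > 0\<close> by (simp_all add: r_def)
  then have "2 * \<bar>r - h\<bar> < p" using h by (simp add: abs_if)
  also have "r - h = s - p * ((s + h) div p)" by (simp add: r_def minus_mult_div_eq_mod[symmetric])
  finally show ?thesis by (rule that)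
qed

section \<open>The cyclotomic ring of prime power level\<close>

locale prime_power_level =
  fixes p b :: nat
  assumes prime_p: "prime p" and b_pos: "b > 0"
begin

definition n :: nat where "n = p ^ b"

definition N :: nat where "N = p ^ (b - 1)"

definition \<zeta> :: complex where "\<zeta> = cis (2 * pi / real n)"

abbreviation R :: "complex set" where "R \<equiv> int_adjoin \<zeta>"

lemma n_eq: "n = p * N"
  unfolding n_def N_def using b_pos by (cases b) auto

lemma p_gt_1: "p > 1"
  using prime_p by (rule prime_gt_1_nat)

lemma N_pos: "N > 0" and n_pos: "n > 0"
  using p_gt_1 by (auto simp: N_def n_def)

lemma N_less_n: "N < n"
  using n_eq N_pos p_gt_1 by simp

lemma n_gt_1: "n > 1"
  using N_less_n N_pos by linarith

lemma totient_n: "totient n = n - N"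
proof -
  have "totient n = N * (p - 1)" using prime_p b_pos by (simp add: n_def N_def totient_prime_power)
  then show ?thesis by (simp add: n_eq diff_mult_distrib2 mult.commute)
qed

lemma coprime_n_iff: "coprime k n \<longleftrightarrow> \<not> p dvd k"
proof -
  have "coprime k n \<longleftrightarrow> coprime p k" using b_pos by (simp add: n_def coprime_commute)
  also have "\<dots> \<longleftrightarrow> \<not> p dvd k"
    using prime_p prime_imp_coprime[of p k] by (metis coprime_absorb_left not_prime_unit)
  finally show ?thesis .
qed

lemma p_neq_1 [simp]: "p \<noteq> Suc 0"
  using p_gt_1 by simp

lemma p_dvd_mult_iff: "p dvd j * k \<longleftrightarrow> p dvd j \<or> p dvd k"
  using prime_p by (rule prime_dvd_mult_iff)

lemma not_p_dvd_power: "\<not> p dvd k \<Longrightarrow> \<not> p dvd k ^ j"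
  using prime_p prime_dvd_power by blast

lemma ex_inverse_mod_n:
  assumes "\<not> p dvd k"
  obtains l where "[k * l = 1] (mod n)" "\<not> p dvd l"
proof -
  obtain l where l: "[k * l = 1] (mod n)"
    using cong_solve_coprime_nat[of k n] assms by (auto simp: coprime_n_iff)
  then have "coprime (k * l) n" using cong_imp_coprime[OF cong_sym[OF l]] by simp
  then have "\<not> p dvd l" by (simp add: coprime_n_iff p_dvd_mult_iff)
  with l show ?thesis by (rule that)
qed

lemma not_p_dvd_n_minus_1 [simp]: "\<not> p dvd n - Suc 0"
  using coprime_diff_one_left_nat[OF n_pos] by (simp add: coprime_n_iff)

lemma primitive_zeta: "primitive_root_of_unity n \<zeta>"
  unfolding \<zeta>_def using n_pos by (rule primitive_root_of_unity_cis)

lemma zeta_power_eq_1_iff: "\<zeta> ^ k = 1 \<longleftrightarrow> n dvd k"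
  using primitive_zeta by (simp add: primitive_root_of_unity_def)

lemma zeta_power_n [simp]: "\<zeta> ^ n = 1"
  by (simp add: zeta_power_eq_1_iff)

lemma zeta_power_eq_iff: "\<zeta> ^ j = \<zeta> ^ k \<longleftrightarrow> [j = k] (mod n)"
  using primitive_zeta n_pos by (rule primitive_root_of_unity_power_eq_iff)

lemma zeta_power_mod: "\<zeta> ^ (k mod n) = \<zeta> ^ k"
  using primitive_zeta by (rule primitive_root_of_unity_power_mod)

lemma zeta_nonzero [simp]: "\<zeta> \<noteq> 0"
  by (simp add: \<zeta>_def)

lemma primitive_zeta_power_p: "primitive_root_of_unity N (\<zeta> ^ p)"
  using primitive_zeta p_gt_1 by (intro primitive_root_of_unity_power) (simp_all add: n_eq)

lemma zeta_power_mult_cnj: "\<zeta> ^ k * cnj (\<zeta> ^ k) = 1"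
proof (rule root_of_unity_mult_cnj[OF _ n_pos])
  have "n dvd k * n" by simp
  then show "(\<zeta> ^ k) ^ n = 1" unfolding power_mult[symmetric] zeta_power_eq_1_iff .
qed

lemma cnj_zeta_power:
  assumes "k \<le> n"
  shows "cnj (\<zeta> ^ k) = \<zeta> ^ (n - k)"
proof -
  have "\<zeta> ^ k * \<zeta> ^ (n - k) = 1" using assms by (simp flip: power_add)
  with zeta_power_mult_cnj[of k] show ?thesis
    by (metis mult_left_cancel zeta_nonzero power_not_zero)
qed

lemma root_of_unity_in_R:
  assumes "z ^ n = 1"
  shows "z \<in> R"
proof -
  have "z \<in> (\<lambda>k. cis (2 * pi * real k / real n)) ` {..<n}"
    using bij_betw_roots_unity[OF n_pos] assms by (simp add: bij_betw_def)
  then obtain k where "z = cis (2 * pi * real k / real n)" by blast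
  then have "z = \<zeta> ^ k" by (simp add: \<zeta>_def DeMoivre mult.commute)
  then show ?thesis by simp
qed

subsection \<open>Irreducibility of the cyclotomic polynomial\<close>

definition Phi :: "int poly" where
  "Phi = (\<Sum>i<p. monom 1 (N * i))"

lemma Phi_root:
  assumes "\<not> p dvd k"
  shows "ipoly Phi (\<zeta> ^ k) = 0"
proof -
  define w where "w = (\<zeta> ^ k) ^ N"
  have "w ^ p = 1" "w \<noteq> 1"
    using assms N_pos unfolding w_def power_mult[symmetric] zeta_power_eq_1_iff n_eq
    by (auto simp: mult_ac)
  moreover have "ipoly Phi (\<zeta> ^ k) = (\<Sum>i<p. w ^ i)" by (simp add: Phi_def w_def power_mult)
  ultimately show ?thesis by (simp add: geometric_sum)
qed

lemma degree_Phi: "degree Phi = n - N" and lead_coeff_Phi: "lead_coeff Phi = 1"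
proof -
  have sum: "Phi = monom 1 (n - N) + (\<Sum>i<p - 1. monom 1 (N * i))"
  proof -
    have "{..<p} = insert (p - 1) {..<p - 1}" using p_gt_1 by auto
    then show ?thesis by (simp add: Phi_def n_eq diff_mult_distrib2 mult.commute)
  qed
  have "degree (\<Sum>i<p - 1. monom (1::int) (N * i)) < n - N"
  proof (rule degree_sum_less)
    show "degree (monom (1::int) (N * i)) < n - N" if "i \<in> {..<p - 1}" for i
    proof -
      have "N * i < N * (p - 1)" using that N_pos by simp
      then show ?thesis by (simp add: degree_monom_eq n_eq diff_mult_distrib2 mult.commute)
    qed
  qed (use N_less_n in simp)
  then show "degree Phi = n - N" "lead_coeff Phi = 1"
    unfolding sum by (simp_all add: degree_add_eq_left degree_monom_eq lead_coeff_add_le coeff_eq_0)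
qed

lemma poly_Phi_1: "poly Phi 1 = int p"
  by (simp add: Phi_def poly_sum poly_monom)

lemma Phi_mult: "(monom 1 N - 1) * Phi = monom 1 n - 1"
proof -
  have "Phi = (\<Sum>i<p. monom 1 N ^ i)" by (simp add: Phi_def monom_power)
  then have "(monom 1 N - 1) * Phi = monom 1 N ^ p - 1" by (simp only: power_diff_1_eq)
  then show ?thesis by (simp add: monom_power n_eq mult.commute)
qed

lemma p_dvd_coeff_Phi_shift:
  assumes "i < n - N"
  shows "int p dvd coeff (Phi \<circ>\<^sub>p [:1, 1:]) i"
proof -
  define F y where "F = Phi \<circ>\<^sub>p [:1, 1:]" and "y = [:1, 1::int:]"
  have y: "of_nat p dvd y ^ p ^ k - (monom 1 (p ^ k) + 1)" for k
  proof -
    have "y = monom 1 1 + 1" by (simp add: y_def monom_Suc monom_0 one_pCons)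
    then show ?thesis
      using prime_dvd_binomial_defect_iterated[OF prime_p, of "monom 1 1 :: int poly" 1 k]
      by (simp add: monom_power)
  qed
  have "((monom 1 N - 1) * Phi) \<circ>\<^sub>p y = (monom 1 n - 1) \<circ>\<^sub>p y" by (simp only: Phi_mult)
  then have "(y ^ N - 1) * F = y ^ n - 1"
    by (simp add: pcompose_mult pcompose_diff F_def y_def pcompose_1 pcompose_monom)
  then have "monom 1 N * F - monom 1 n = (y ^ n - (monom 1 n + 1)) - (y ^ N - (monom 1 N + 1)) * F"
    by (simp add: algebra_simps)
  also have "of_nat p dvd \<dots>"
    unfolding n_def N_def by (intro dvd_diff dvd_mult2 y)
  finally obtain Q where "monom 1 N * F - monom 1 n = of_nat p * Q" by (rule dvdE)
  then have "coeff (monom 1 N * F - monom 1 n) (N + i) = coeff (of_nat p * Q) (N + i)" by simp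
  then have "coeff F i = int p * coeff Q (N + i)"
    using assms by (simp add: coeff_monom_mult of_nat_poly split: if_splits)
  then show ?thesis unfolding F_def by simp
qed

theorem irreducible_Phi: "irreducible Phi"
proof (rule irreducible_if_pcompose_shift_irreducible)
  have degree: "degree (Phi \<circ>\<^sub>p [:1, 1:]) = n - N" by (simp add: degree_pcompose degree_Phi)
  have const: "coeff (Phi \<circ>\<^sub>p [:1, 1:]) 0 = int p"
    using poly_pcompose[of Phi "[:1, 1:]" 0] by (simp add: poly_0_coeff_0 poly_Phi_1)
  show "irreducible (Phi \<circ>\<^sub>p [:1, 1:])"
  proof (rule eisenstein_irreducible[of "int p"])
    show "prime_elem (int p)" using prime_p by simp
    show "lead_coeff (Phi \<circ>\<^sub>p [:1, 1:]) = 1" by (simp add: lead_coeff_comp lead_coeff_Phi)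
    show "degree (Phi \<circ>\<^sub>p [:1, 1:]) > 0" using N_less_n by (simp add: degree)
    show "int p dvd coeff (Phi \<circ>\<^sub>p [:1, 1:]) i" if "i < degree (Phi \<circ>\<^sub>p [:1, 1:])" for i
      using that by (simp only: degree p_dvd_coeff_Phi_shift)
    show "\<not> (int p)\<^sup>2 dvd coeff (Phi \<circ>\<^sub>p [:1, 1:]) 0"
      unfolding const using p_gt_1 by (simp add: power2_eq_square)
  qed
qed

lemma Phi_dvd_if_root: "ipoly P \<zeta> = 0 \<Longrightarrow> Phi dvd P"
  using irreducible_dvd_if_common_root[OF irreducible_Phi] Phi_root[of 1] by simp

subsection \<open>The Galois action\<close>

text \<open>
  Only \<open>gal k x\<close> with \<open>x \<in> R\<close> and \<open>\<not> p dvd k\<close> is meaningful; the polynomial chosen is then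
  irrelevant, because all polynomials vanishing at \<open>\<zeta>\<close> are multiples of \<open>Phi\<close>.
\<close>

definition gal :: "nat \<Rightarrow> complex \<Rightarrow> complex" where
  "gal k x = ipoly (SOME P. x = ipoly P \<zeta>) (\<zeta> ^ k)"

lemma gal_ipoly [simp]:
  assumes "\<not> p dvd k"
  shows "gal k (ipoly P \<zeta>) = ipoly P (\<zeta> ^ k)"
proof -
  define Q where "Q = (SOME Q. ipoly P \<zeta> = ipoly Q \<zeta>)"
  have "ipoly P \<zeta> = ipoly Q \<zeta>" unfolding Q_def by (rule someI) (rule refl)
  then have "ipoly (P - Q) \<zeta> = 0" by simp
  then obtain S where "P - Q = Phi * S" using Phi_dvd_if_root by blast
  then have "ipoly (P - Q) (\<zeta> ^ k) = 0" using Phi_root[OF assms] by simp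
  then show ?thesis by (simp add: gal_def Q_def[symmetric])
qed

lemma gal_in_R [simp]: "x \<in> R \<Longrightarrow> \<not> p dvd k \<Longrightarrow> gal k x \<in> R"
  by (auto elim!: int_adjoinE simp flip: ipoly_pcompose_monom)

context
  fixes k :: nat
  assumes k: "\<not> p dvd k"
begin

lemma gal_add [simp]: "x \<in> R \<Longrightarrow> y \<in> R \<Longrightarrow> gal k (x + y) = gal k x + gal k y"
  by (auto elim!: int_adjoinE simp flip: ipoly_add simp: k)

lemma gal_mult [simp]: "x \<in> R \<Longrightarrow> y \<in> R \<Longrightarrow> gal k (x * y) = gal k x * gal k y"
  by (auto elim!: int_adjoinE simp flip: ipoly_mult simp: k)

lemma gal_diff [simp]: "x \<in> R \<Longrightarrow> y \<in> R \<Longrightarrow> gal k (x - y) = gal k x - gal k y"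
  by (auto elim!: int_adjoinE simp flip: ipoly_diff simp: k)

lemma gal_power [simp]: "x \<in> R \<Longrightarrow> gal k (x ^ j) = gal k x ^ j"
  by (auto elim!: int_adjoinE simp flip: ipoly_power simp: k)

lemma gal_of_int [simp]: "gal k (of_int a) = of_int a"
  using gal_ipoly[OF k, of "[:a:]"] by simp

lemma gal_of_nat [simp]: "gal k (of_nat a) = of_nat a"
  using gal_of_int[of "int a"] by simp

lemma gal_sum:
  "(\<And>i. i \<in> A \<Longrightarrow> f i \<in> R) \<Longrightarrow> gal k (sum f A) = (\<Sum>i\<in>A. gal k (f i))"
  by (induction A rule: infinite_finite_induct) (simp_all, (metis gal_of_int of_int_0)+)

lemma gal_zeta [simp]: "gal k \<zeta> = \<zeta> ^ k"
  using gal_ipoly[OF k, of "[:0, 1:]"] by simp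

lemma gal_gal [simp]: "x \<in> R \<Longrightarrow> \<not> p dvd j \<Longrightarrow> gal j (gal k x) = gal (j * k) x"
  using k
  by (auto elim!: int_adjoinE simp: p_dvd_mult_iff power_mult simp flip: ipoly_pcompose_monom)

end

lemma gal_1 [simp]: "x \<in> R \<Longrightarrow> gal (Suc 0) x = x"
  by (auto elim!: int_adjoinE simp: gal_ipoly[of "Suc 0"])

lemma gal_cong: "[j = k] (mod n) \<Longrightarrow> gal j x = gal k x"
  by (simp add: gal_def zeta_power_eq_iff[THEN iffD2])

lemma cnj_eq_gal: "x \<in> R \<Longrightarrow> cnj x = gal (n - 1) x"
  using cnj_zeta_power[of 1] n_pos by (auto elim!: int_adjoinE simp: cnj_ipoly)

lemma cnj_in_R [simp]: "x \<in> R \<Longrightarrow> cnj x \<in> R"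
  by (simp add: cnj_eq_gal)

lemma gal_cnj [simp]: "x \<in> R \<Longrightarrow> \<not> p dvd k \<Longrightarrow> gal k (cnj x) = cnj (gal k x)"
  by (simp add: cnj_eq_gal mult.commute)

abbreviation cdvd :: "complex \<Rightarrow> complex \<Rightarrow> bool" (infix "cdvd" 50) where
  "x cdvd y \<equiv> adjoin_dvd \<zeta> x y"

end

section \<open>The prime above p\<close>

context prime_power_level
begin

definition \<pi> :: complex where "\<pi> = 1 - \<zeta>"

lemma pi_in_R [simp]: "\<pi> \<in> R"
  by (simp add: \<pi>_def)

lemma pi_nonzero [simp]: "\<pi> \<noteq> 0"
  using zeta_power_eq_1_iff[of 1] n_gt_1 by (auto simp: \<pi>_def)

lemma pi_cdvd_one_minus_zeta_power: "\<pi> cdvd 1 - \<zeta> ^ k"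
  unfolding \<pi>_def by (intro one_minus_power_adjoin_dvd) simp

lemma one_minus_zeta_power_cdvd_pi:
  assumes "\<not> p dvd k"
  shows "1 - \<zeta> ^ k cdvd \<pi>"
proof -
  obtain l where "[k * l = 1] (mod n)" using assms by (rule ex_inverse_mod_n)
  then have "(\<zeta> ^ k) ^ l = \<zeta> ^ 1" unfolding power_mult[symmetric] by (simp only: zeta_power_eq_iff)
  then show ?thesis using one_minus_power_adjoin_dvd[of "\<zeta> ^ k" \<zeta> l] by (simp add: \<pi>_def)
qed

lemma cnj_pi: "cnj \<pi> = 1 - \<zeta> ^ (n - 1)"
  using cnj_zeta_power[of 1] n_pos by (simp add: \<pi>_def)

lemma pi_cdvd_cnj_pi: "\<pi> cdvd cnj \<pi>" and cnj_pi_cdvd_pi: "cnj \<pi> cdvd \<pi>"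
  unfolding cnj_pi
  by (rule pi_cdvd_one_minus_zeta_power, rule one_minus_zeta_power_cdvd_pi) simp

lemma pi_cdvd_cnj_iff:
  assumes "x \<in> R"
  shows "\<pi> cdvd cnj x \<longleftrightarrow> \<pi> cdvd x"
proof -
  have "\<pi> cdvd cnj y" if "\<pi> cdvd y" for y
    using that
  proof (rule adjoin_dvdE)
    fix z assume z: "z \<in> R" "y = \<pi> * z"
    have "\<pi> cdvd cnj \<pi> * cnj z" using pi_cdvd_cnj_pi z by (intro adjoin_dvd_mult_right) auto
    then show ?thesis by (simp add: z)
  qed
  from this[of x] this[of "cnj x"] show ?thesis by auto
qed

lemma mult_zeta_power_cong_mod_pi:
  assumes "x \<in> R"
  shows "\<pi> cdvd x * \<zeta> ^ k - x"
proof -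
  have "x * \<zeta> ^ k - x = - (x * (1 - \<zeta> ^ k))" by (simp add: algebra_simps)
  then show ?thesis
    using assms pi_cdvd_one_minus_zeta_power by (simp only: adjoin_dvd_minus adjoin_dvd_mult_left)
qed

lemma ex_int_cong_mod_pi:
  assumes "x \<in> R"
  shows "\<exists>a. \<pi> cdvd x - of_int a"
proof -
  obtain P where P: "x = ipoly P \<zeta>" using assms by (rule int_adjoinE)
  have "poly (P - [:poly P 1:]) 1 = 0" by simp
  then obtain S where "P - [:poly P 1:] = [:-1, 1:] * S"
    unfolding poly_eq_0_iff_dvd by (auto elim: dvdE)
  then have "ipoly (P - [:poly P 1:]) \<zeta> = ipoly ([:-1, 1:] * S) \<zeta>" by (rule arg_cong)
  then have "x - of_int (poly P 1) = \<pi> * ipoly (- S) \<zeta>" by (simp add: P \<pi>_def algebra_simps)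
  then have "\<pi> cdvd x - of_int (poly P 1)" by (rule adjoin_dvdI) simp
  then show ?thesis ..
qed

lemma card_totatives_n: "card (totatives n) = n - N"
  using totient_n by (simp add: totient_def)

lemma totatives_n: "totatives n = {k. k < n \<and> \<not> p dvd k}"
  using totatives_less[of _ n] n_gt_1 by (auto simp: in_totatives_iff coprime_n_iff intro: gr0I)

lemma prod_one_minus_zeta_power: "(\<Prod>k\<in>totatives n. 1 - \<zeta> ^ k) = of_nat p"
proof -
  define P Q where "P = map_poly (of_int :: int \<Rightarrow> complex) Phi"
    and "Q = (\<Prod>k\<in>totatives n. [:- (\<zeta> ^ k), 1:])"
  have degree_Q: "degree Q = n - N"
    unfolding Q_def by (subst degree_prod_eq_sum_degree) (auto simp: card_totatives_n)
  have "P = Q"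
  proof (rule poly_eqI_degree_lead_coeff[where n = "n - N" and A = "(\<lambda>k. \<zeta> ^ k) ` totatives n"])
    have "coeff P (n - N) = 1" using lead_coeff_Phi by (simp add: P_def coeff_map_poly degree_Phi)
    moreover have "lead_coeff Q = 1" unfolding Q_def by (simp add: lead_coeff_prod)
    ultimately show "coeff P (n - N) = coeff Q (n - N)" using degree_Q by simp
    have "inj_on (\<lambda>k. \<zeta> ^ k) (totatives n)"
      by (auto simp: inj_on_def zeta_power_eq_iff totatives_n cong_def)
    then show "n - N \<le> card ((\<lambda>k. \<zeta> ^ k) ` totatives n)" by (simp add: card_image card_totatives_n)
    show "degree P \<le> n - N"
      unfolding P_def degree_Phi[symmetric]
      by (rule degree_le) (auto simp: coeff_map_poly coeff_eq_0)
    show "degree Q \<le> n - N" using degree_Q by simp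
    show "poly P z = poly Q z" if "z \<in> (\<lambda>k. \<zeta> ^ k) ` totatives n" for z
      using that Phi_root by (auto simp: P_def Q_def ipoly_def poly_prod totatives_n)
  qed
  then have "poly Q 1 = ipoly Phi 1" by (simp add: P_def ipoly_def)
  then show ?thesis by (simp add: Q_def poly_prod ipoly_at_1 poly_Phi_1)
qed

lemma pi_cdvd_of_int_iff: "\<pi> cdvd of_int a \<longleftrightarrow> int p dvd a"
proof
  assume "\<pi> cdvd of_int a"
  then obtain z where "z \<in> R" "of_int a = \<pi> * z" by (rule adjoin_dvdE)
  then obtain Q where "of_int a = \<pi> * ipoly Q \<zeta>" by (metis int_adjoinE)
  then have "ipoly ([:a:] - [:1, -1:] * Q) \<zeta> = 0" by (simp add: \<pi>_def algebra_simps)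
  then obtain S where "[:a:] - [:1, -1:] * Q = Phi * S" using Phi_dvd_if_root by blast
  then have "poly ([:a:] - [:1, -1:] * Q) 1 = poly (Phi * S) 1" by simp
  then show "int p dvd a" by (simp add: poly_Phi_1)
next
  assume "int p dvd a"
  then obtain a' where a: "a = int p * a'" by (rule dvdE)
  have "1 \<in> totatives n" using n_pos by simp
  then have "of_nat p = (1 - \<zeta> ^ 1) * (\<Prod>k\<in>totatives n - {1}. 1 - \<zeta> ^ k)"
    unfolding prod_one_minus_zeta_power[symmetric] by (rule prod.remove[OF finite_totatives])
  then have "\<pi> cdvd of_nat p" by (auto simp: \<pi>_def intro!: int_adjoin_prod)
  then show "\<pi> cdvd of_int a" unfolding a by (simp add: adjoin_dvd_mult_right)
qed

lemma pi_cdvd_iff_of_cong: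
  assumes "\<pi> cdvd x - of_int a"
  shows "\<pi> cdvd x \<longleftrightarrow> int p dvd a"
  using adjoin_dvd_diff[of \<zeta> \<pi> x "x - of_int a"] adjoin_dvd_add[OF assms, of "of_int a"] assms
  by (auto simp: pi_cdvd_of_int_iff)

lemma cong_mod_pi_mult:
  assumes "\<pi> cdvd x - of_int a" "\<pi> cdvd y - of_int c" "x \<in> R"
  shows "\<pi> cdvd x * y - of_int (a * c)"
proof -
  have "\<pi> cdvd x * (y - of_int c) + (x - of_int a) * of_int c"
    using assms by (intro adjoin_dvd_add adjoin_dvd_mult_left adjoin_dvd_mult_right) auto
  then show ?thesis by (simp add: algebra_simps)
qed

lemma pi_prime:
  assumes "\<pi> cdvd x * y" "x \<in> R" "y \<in> R"
  shows "\<pi> cdvd x \<or> \<pi> cdvd y"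
proof -
  obtain a c where "\<pi> cdvd x - of_int a" "\<pi> cdvd y - of_int c"
    using assms ex_int_cong_mod_pi by blast
  moreover from this have "\<pi> cdvd x * y \<longleftrightarrow> int p dvd a * c"
    using assms(2) by (intro pi_cdvd_iff_of_cong cong_mod_pi_mult)
  ultimately show ?thesis
    using assms(1) prime_p by (simp add: pi_cdvd_iff_of_cong prime_dvd_mult_iff)
qed

lemma pi_cdvd_mult_cnj_iff: "x \<in> R \<Longrightarrow> \<pi> cdvd x * cnj x \<longleftrightarrow> \<pi> cdvd x"
  using pi_prime[of x "cnj x"] by (auto simp: pi_cdvd_cnj_iff intro: adjoin_dvd_mult_right)

subsection \<open>Weil numbers\<close>

definition weil_number :: "nat \<Rightarrow> complex \<Rightarrow> bool" where
  "weil_number m x \<longleftrightarrow> x \<in> R \<and> x * cnj x = of_nat m"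

lemma weil_number_in_R [simp]: "weil_number m x \<Longrightarrow> x \<in> R"
  and weil_number_mult_cnj: "weil_number m x \<Longrightarrow> x * cnj x = of_nat m"
  by (simp_all add: weil_number_def)

lemma weil_number_gal: "weil_number m x \<Longrightarrow> \<not> p dvd k \<Longrightarrow> weil_number m (gal k x)"
  unfolding weil_number_def by (metis cnj_in_R gal_cnj gal_in_R gal_mult gal_of_nat)

lemma weil_number_cnj: "weil_number m x \<Longrightarrow> weil_number m (cnj x)"
  by (simp add: weil_number_def mult.commute)

lemma weil_number_mult: "weil_number j x \<Longrightarrow> weil_number k y \<Longrightarrow> weil_number (j * k) (x * y)"
  by (simp add: weil_number_def) (metis mult.commute mult.left_commute)

lemma weil_number_zeta_power: "weil_number 1 (\<zeta> ^ k)"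
  using zeta_power_mult_cnj by (simp add: weil_number_def)

lemma weil_number_cong_mod_pi:
  assumes x: "weil_number m x" and a: "\<pi> cdvd x - of_int a"
  shows "int p dvd a\<^sup>2 - int m"
proof -
  have "\<pi> cdvd cnj x - of_int a" using a pi_cdvd_cnj_iff[of "x - of_int a"] x by simp
  with a have "\<pi> cdvd x * cnj x - of_int (a * a)" using x by (intro cong_mod_pi_mult) auto
  also have "x * cnj x - of_int (a * a) = - of_int (a\<^sup>2 - int m)"
    using x by (simp add: weil_number_mult_cnj power2_eq_square)
  finally have "\<pi> cdvd of_int (a\<^sup>2 - int m)" using adjoin_dvd_minus by force
  then show ?thesis by (simp only: pi_cdvd_of_int_iff)
qed

end

locale odd_prime_power_level = prime_power_level +
  assumes odd_p: "odd p"
begin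

lemma p_ge_3: "p \<ge> 3"
  using p_gt_1 odd_p by (cases "p = 2") auto

lemma odd_n: "odd n"
  using odd_p by (simp add: n_def)

definition half_totatives :: "nat set" where
  "half_totatives = {k \<in> totatives n. 2 * k < n}"

definition half_prod :: complex where
  "half_prod = (\<Prod>k\<in>half_totatives. 1 - \<zeta> ^ k)"

lemma finite_half_totatives [simp]: "finite half_totatives"
  by (simp add: half_totatives_def)

lemma totatives_n_reflect:
  assumes "k \<in> totatives n"
  shows "n - k \<in> totatives n"
proof -
  have k: "k < n" "\<not> p dvd k" using assms by (simp_all add: totatives_n)
  have "p dvd n" by (simp add: n_eq)
  then have "\<not> p dvd n - k" using k by (metis dvd_diffD1 less_imp_le)
  moreover have "k \<noteq> 0" using k by (metis dvd_0_right)
  ultimately show ?thesis using n_pos by (simp add: totatives_n)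
qed

lemma totatives_n_split: "totatives n = half_totatives \<union> (\<lambda>k. n - k) ` half_totatives"
proof (intro equalityI subsetI)
  fix k assume k: "k \<in> totatives n"
  show "k \<in> half_totatives \<union> (\<lambda>k. n - k) ` half_totatives"
  proof (cases "2 * k < n")
    case False
    have "2 * k \<noteq> n" using odd_n by (metis dvd_triv_left)
    with False have "2 * (n - k) < n" using n_pos by linarith
    then have "n - k \<in> half_totatives"
      using totatives_n_reflect[OF k] by (simp add: half_totatives_def)
    moreover have "k = n - (n - k)" using k by (simp add: totatives_n)
    ultimately show ?thesis by blast
  qed (use k in \<open>simp add: half_totatives_def\<close>)
qed (auto simp: half_totatives_def intro: totatives_n_reflect)

lemma half_totatives_disjoint: "half_totatives \<inter> (\<lambda>k. n - k) ` half_totatives = {}"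
  by (auto simp: half_totatives_def)

lemma inj_on_reflect_half_totatives: "inj_on (\<lambda>k. n - k) half_totatives"
  by (auto simp: half_totatives_def inj_on_def)

lemma card_half_totatives: "2 * card half_totatives = n - N"
proof -
  have "card (totatives n) = card half_totatives + card ((\<lambda>k. n - k) ` half_totatives)"
    using half_totatives_disjoint by (subst totatives_n_split) (intro card_Un_disjoint, auto)
  then show ?thesis by (simp add: card_image inj_on_reflect_half_totatives card_totatives_n)
qed

lemma half_prod_weil_number: "weil_number p half_prod"
proof -
  have "cnj half_prod = (\<Prod>k\<in>half_totatives. 1 - \<zeta> ^ (n - k))"
    unfolding half_prod_def cnj_prod
    by (intro prod.cong) (auto simp: half_totatives_def cnj_zeta_power simp del: complex_cnj_power)
  also have "\<dots> = (\<Prod>k\<in>(\<lambda>k. n - k) ` half_totatives. 1 - \<zeta> ^ k)"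
    by (simp add: prod.reindex inj_on_reflect_half_totatives)
  finally have "half_prod * cnj half_prod =
      (\<Prod>k\<in>half_totatives \<union> (\<lambda>k. n - k) ` half_totatives. 1 - \<zeta> ^ k)"
    unfolding half_prod_def using half_totatives_disjoint by (subst prod.union_disjoint) auto
  then show ?thesis
    by (simp add: weil_number_def half_prod_def flip: totatives_n_split)
      (simp add: prod_one_minus_zeta_power)
qed

lemma pi_power_cdvd_p: "\<pi> ^ (2 * card half_totatives) cdvd of_nat p"
proof -
  have "(\<Prod>k\<in>totatives n. \<pi>) cdvd (\<Prod>k\<in>totatives n. 1 - \<zeta> ^ k)"
    by (intro adjoin_dvd_prod_mono pi_cdvd_one_minus_zeta_power)
  then show ?thesis by (simp add: prod_one_minus_zeta_power card_totatives_n card_half_totatives)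
qed

lemma half_prod_cdvd_pi_power: "half_prod cdvd \<pi> ^ card half_totatives"
proof -
  have "half_prod cdvd (\<Prod>k\<in>half_totatives. \<pi>)"
    unfolding half_prod_def
    by (intro adjoin_dvd_prod_mono one_minus_zeta_power_cdvd_pi)
      (simp add: half_totatives_def totatives_n)
  then show ?thesis by simp
qed

lemma pi_power_cdvd_weil_number:
  assumes x: "weil_number (p * m) x" and "k \<le> card half_totatives"
  shows "\<pi> ^ k cdvd x"
  using assms(2)
proof (induction k)
  case 0
  show ?case using x by (simp add: adjoin_dvd_def)
next
  case (Suc k)
  then have "\<pi> ^ k cdvd x" by simp
  then obtain y where y: "y \<in> R" "x = \<pi> ^ k * y" by (rule adjoin_dvdE)
  obtain w where w: "w \<in> R" "\<pi> = cnj \<pi> * w" using cnj_pi_cdvd_pi by (rule adjoin_dvdE)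
  have "\<pi> ^ (2 * k + 1) cdvd \<pi> ^ (2 * card half_totatives)"
    using Suc.prems by (intro le_imp_power_adjoin_dvd) auto
  then have "\<pi> ^ (2 * k + 1) cdvd of_nat p"
    using pi_power_cdvd_p by (rule adjoin_dvd_trans)
  then have "\<pi> ^ (2 * k) * \<pi> cdvd of_nat p * (of_nat m * w ^ k)"
    using w by (intro adjoin_dvd_mult_right) (auto simp: mult.commute)
  also have "of_nat p * (of_nat m * w ^ k) = x * cnj x * w ^ k"
    using x by (simp add: weil_number_mult_cnj)
  also have "\<dots> = \<pi> ^ k * (cnj \<pi> * w) ^ k * (y * cnj y)"
    by (simp add: y power_mult_distrib mult_ac)
  also have "\<dots> = \<pi> ^ (2 * k) * (y * cnj y)" by (simp flip: w(2) add: mult_2 power_add)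
  finally have "\<pi> cdvd y * cnj y" by (simp add: adjoin_dvd_mult_cancel_left)
  then have "\<pi> cdvd y" using y by (simp add: pi_cdvd_mult_cnj_iff)
  then have "\<pi> ^ k * \<pi> cdvd \<pi> ^ k * y" by (simp add: adjoin_dvd_mult_cancel_left)
  then show ?case by (simp add: y mult.commute)
qed

lemma weil_number_divide_p:
  assumes x: "weil_number (p * m) x"
  obtains y where "weil_number m y"
proof -
  have "half_prod cdvd x"
    using half_prod_cdvd_pi_power pi_power_cdvd_weil_number[OF x order_refl]
    by (rule adjoin_dvd_trans)
  then obtain y where y: "y \<in> R" "x = half_prod * y" by (rule adjoin_dvdE)
  have "of_nat p * (y * cnj y) = (half_prod * cnj half_prod) * (y * cnj y)"
    using half_prod_weil_number by (simp add: weil_number_mult_cnj)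
  also have "\<dots> = of_nat p * of_nat m"
    using weil_number_mult_cnj[OF x] by (simp add: y mult_ac)
  finally have "weil_number m y" using p_gt_1 y by (simp add: weil_number_def)
  then show ?thesis by (rule that)
qed

lemma weil_number_divide_p_power:
  assumes "weil_number (p ^ c * m) x"
  obtains y where "weil_number m y"
  using assms
proof (induction c arbitrary: x thesis)
  case (Suc c)
  then have "weil_number (p * (p ^ c * m)) x" by (simp add: mult_ac)
  then obtain y where "weil_number (p ^ c * m) y" by (rule weil_number_divide_p)
  then show ?case using Suc by blast
qed simp

end

section \<open>The counting argument for planar difference sets\<close>

lemma is_square_if_int_square:
  fixes x :: int
  assumes "x\<^sup>2 = int m"
  shows "is_square m"
proof -
  have "int m = int ((nat \<bar>x\<bar>)\<^sup>2)" using assms by simp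
  then have "m = (nat \<bar>x\<bar>)\<^sup>2" by (simp only: of_nat_eq_iff)
  then show ?thesis by (rule is_nth_powerI)
qed

lemma planar_excess_bound:
  fixes p m L :: int
  assumes m: "2 \<le> m" and L: "1 \<le> L" and p: "m * m + m + 2 \<le> p"
  shows "min ((2 * m - 1)\<^sup>2) ((m + L)\<^sup>2) < m + p * L"
proof (cases "L \<le> m * m - m")
  case True
  then have "0 \<le> (L - 1) * (m * m - m - L)" using L by simp
  then have "(m + L)\<^sup>2 < m + (m * m + m + 2) * L"
    using L by (simp add: power2_eq_square algebra_simps)
  moreover have "(m * m + m + 2) * L \<le> p * L" using p L by (intro mult_right_mono) auto
  ultimately show ?thesis by linarith
next
  case False
  have "(4 * m - 1) * (m - 1) < (m * m + m + 2) * (m * m - m + 1)"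
  proof (rule mult_le_less_imp_less)
    have "0 \<le> (m - 1) * (m - 2)" using m by simp
    then show "4 * m - 1 \<le> m * m + m + 2" by (simp add: algebra_simps)
    have "0 \<le> (m - 1) * (m - 1)" by simp
    then show "m - 1 < m * m - m + 1" by (simp add: algebra_simps)
  qed (use m in auto)
  also have "\<dots> \<le> p * L"
  proof (rule mult_mono)
    have "0 \<le> m * (m - 1)" "0 \<le> m * (m + 1)" using m by simp_all
    then show "0 \<le> m * m - m + 1" "0 \<le> p" using p by (simp_all add: algebra_simps)
  qed (use p False in auto)
  finally have "(2 * m - 1)\<^sup>2 < m + p * L" by (simp add: power2_eq_square algebra_simps)
  then show ?thesis by linarith
qed

lemma planar_counting_bound:
  fixes p m A E T S :: int
  assumes m: "m \<ge> 2" and T: "p * E - T = (p - 1) * m" "0 \<le> T" "T \<le> A\<^sup>2"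
    and A: "0 \<le> A" "A \<le> E" "(p + 1) * A \<le> 2 * ((p - 1) * m)"
    and S: "\<bar>S\<bar> \<le> A" "p dvd S\<^sup>2 - m" "S\<^sup>2 \<noteq> m"
  shows "p \<le> m\<^sup>2 + m + 1"
proof (rule ccontr)
  assume "\<not> ?thesis"
  then have p: "m * m + m + 2 \<le> p" by (simp add: power2_eq_square)
  have "0 < m * m" using m by simp
  then have "m < p" "0 < p" using p m by linarith+
  define L where "L = E - m"
  have TL: "T = m + p * L" using T(1) by (simp add: L_def algebra_simps)
  consider (neg) "L \<le> -1" | (zero) "L = 0" | (pos) "1 \<le> L" by linarith
  then show False
  proof cases
    case neg
    then have "p * L \<le> p * (-1)" using \<open>0 < p\<close> by (intro mult_left_mono) auto
    then show False using TL T(2) \<open>m < p\<close> by linarith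
  next
    case zero
    then have "\<bar>S\<bar> \<le> \<bar>m\<bar>" using S(1) A(2) m by (simp add: L_def)
    then have "S\<^sup>2 \<le> m * m" by (simp only: abs_le_square_iff power2_eq_square)
    moreover have "S\<^sup>2 \<ge> 0" by simp
    ultimately have "\<bar>S\<^sup>2 - m\<bar> < p" using p m unfolding abs_less_iff by linarith
    then show False using S(2,3) zdvd_imp_le[of p "\<bar>S\<^sup>2 - m\<bar>"] by simp
  next
    case pos
    have "A \<le> 2 * m - 1"
    proof (rule ccontr)
      assume "\<not> ?thesis"
      then have "(p + 1) * (2 * m) \<le> (p + 1) * A" using \<open>0 < p\<close> by (intro mult_left_mono) auto
      then have "(p + 1) * (2 * m) \<le> 2 * ((p - 1) * m)" using A(3) by linarith
      then show False using m by (simp add: algebra_simps)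
    qed
    then have "A\<^sup>2 \<le> (2 * m - 1)\<^sup>2" using A(1) by (rule power_mono)
    moreover have "A\<^sup>2 \<le> (m + L)\<^sup>2" using A(1,2) by (intro power_mono) (auto simp: L_def)
    ultimately have "T \<le> min ((2 * m - 1)\<^sup>2) ((m + L)\<^sup>2)" using T(3) by simp
    then show False using planar_excess_bound[OF m pos p] TL by linarith
  qed
qed

section \<open>The trace identity\<close>

context prime_power_level
begin

text \<open>
  A function on \<open>{..<n}\<close> stands for a function on \<open>\<int>/n\<close>. The cosets of the subgroup of order \<open>p\<close> are
  the fibres of the reduction modulo \<open>N\<close>.
\<close>

definition fibre :: "nat \<Rightarrow> nat set" where
  "fibre w = {i. i < n \<and> i mod N = w}"

definition fibre_sum :: "(nat \<Rightarrow> int) \<Rightarrow> nat \<Rightarrow> int" where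
  "fibre_sum c w = (\<Sum>i\<in>fibre w. c i)"

definition dft :: "(nat \<Rightarrow> int) \<Rightarrow> nat \<Rightarrow> complex" where
  "dft c k = (\<Sum>i<n. of_int (c i) * \<zeta> ^ (i * k))"

lemma finite_fibre [simp]: "finite (fibre w)"
  by (simp add: fibre_def)

lemma self_in_fibre [simp]: "w < N \<Longrightarrow> w \<in> fibre w"
  using N_less_n by (simp add: fibre_def)

lemma fibre_eq_image:
  assumes "w < N"
  shows "fibre w = (\<lambda>j. w + N * j) ` {..<p}"
proof (intro equalityI subsetI)
  fix i assume "i \<in> fibre w"
  then have i: "i < n" "i mod N = w" by (auto simp: fibre_def)
  then have "i = w + N * (i div N)" by (metis add.commute mult_div_mod_eq)
  moreover have "i div N < p" using i by (simp add: n_eq less_mult_imp_div_less)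
  ultimately show "i \<in> (\<lambda>j. w + N * j) ` {..<p}" by blast
next
  fix i assume "i \<in> (\<lambda>j. w + N * j) ` {..<p}"
  then obtain j where j: "i = w + N * j" "j < p" by auto
  then have "i < N * (j + 1)" using assms by simp
  also have "\<dots> \<le> N * p" using j by (intro mult_left_mono) auto
  finally show "i \<in> fibre w" using j assms by (simp add: fibre_def n_eq mult.commute)
qed

lemma inj_on_fibre_param: "inj_on (\<lambda>j. w + N * j) A"
  using N_pos by (simp add: inj_on_def)

lemma card_fibre: "w < N \<Longrightarrow> card (fibre w) = p"
  by (simp add: fibre_eq_image card_image inj_on_fibre_param)

lemma sum_fibres: "(\<Sum>w<N. \<Sum>i\<in>fibre w. f i) = (\<Sum>i<n. f i)"
proof -
  have "(\<Sum>w<N. sum f {i \<in> {..<n}. i mod N = w}) = (\<Sum>i<n. f i)"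
    using N_pos by (intro sum.group) auto
  then show ?thesis by (simp add: fibre_def)
qed

lemma sum_zeta_fibre:
  assumes "w < N"
  shows "(\<Sum>i\<in>fibre w. \<zeta> ^ i) = 0"
proof -
  have "(\<Sum>i\<in>fibre w. \<zeta> ^ i) = \<zeta> ^ w * ipoly Phi (\<zeta> ^ 1)"
    by (simp add: fibre_eq_image[OF assms] sum.reindex inj_on_fibre_param Phi_def power_add
        sum_distrib_left)
  also have "\<dots> = 0" by (subst Phi_root) auto
  finally show ?thesis .
qed

lemma dft_in_R [simp]: "dft c k \<in> R"
  by (auto simp: dft_def)

lemma gal_dft: "\<not> p dvd k \<Longrightarrow> gal k (dft c 1) = dft c k"
  by (simp add: dft_def gal_sum mult.commute flip: power_mult)

lemma dft_diff: "dft (\<lambda>i. c i - d i) k = dft c k - dft d k"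
  by (simp add: dft_def sum_subtractf left_diff_distrib)

lemma dft_fibre_const: "dft (\<lambda>i. v (i mod N)) 1 = 0"
proof -
  have "dft (\<lambda>i. v (i mod N)) 1 = (\<Sum>w<N. \<Sum>i\<in>fibre w. of_int (v w) * \<zeta> ^ i)"
    by (simp add: dft_def fibre_def flip: sum_fibres)
  also have "\<dots> = 0" by (simp add: sum_zeta_fibre flip: sum_distrib_left)
  finally show ?thesis .
qed

lemma ex_dft:
  assumes "x \<in> R"
  shows "\<exists>c. x = dft c 1"
proof -
  obtain P where P: "x = ipoly P \<zeta>" using assms by (rule int_adjoinE)
  define c where "c i = (\<Sum>j | j \<le> degree P \<and> j mod n = i. coeff P j)" for i
  have "x = (\<Sum>j\<le>degree P. of_int (coeff P j) * \<zeta> ^ j)"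
    unfolding P by (subst poly_as_sum_of_monoms[symmetric]) simp
  also have "\<dots> = (\<Sum>i<n. \<Sum>j | j \<in> {..degree P} \<and> j mod n = i. of_int (coeff P j) * \<zeta> ^ j)"
    using n_pos by (intro sum.group[symmetric]) auto
  also have "\<dots> = (\<Sum>i<n. \<Sum>j | j \<le> degree P \<and> j mod n = i. of_int (coeff P j) * \<zeta> ^ i)"
    by (intro sum.cong refl) (auto simp: zeta_power_mod)
  also have "\<dots> = dft c 1"
    by (simp add: dft_def c_def sum_distrib_right)
  finally show ?thesis by blast
qed

lemma dft_energy: "(\<Sum>k<n. dft c k * cnj (dft c k)) = of_int (int n * (\<Sum>i<n. (c i)\<^sup>2))"
  using parseval_roots_of_unity[OF primitive_zeta, of "\<lambda>i. of_int (c i)"]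
  by (simp add: dft_def power2_eq_square)

lemma dft_p_mult: "dft c (p * k) = (\<Sum>w<N. of_int (fibre_sum c w) * (\<zeta> ^ p) ^ (w * k))"
proof -
  have "dft c (p * k) = (\<Sum>w<N. \<Sum>i\<in>fibre w. of_int (c i) * (\<zeta> ^ p) ^ (i * k))"
    by (simp add: dft_def sum_fibres mult_ac flip: power_mult)
  also have "\<dots> = (\<Sum>w<N. \<Sum>i\<in>fibre w. of_int (c i) * (\<zeta> ^ p) ^ (w * k))"
  proof (intro sum.cong refl)
    have "(\<zeta> ^ p) ^ i = (\<zeta> ^ p) ^ w" if "i \<in> fibre w" for i w
      using that primitive_root_of_unity_power_mod[OF primitive_zeta_power_p]
      by (auto simp: fibre_def)
    then show "of_int (c i) * (\<zeta> ^ p) ^ (i * k) = of_int (c i) * (\<zeta> ^ p) ^ (w * k)"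
      if "i \<in> fibre w" for i w
      using that by (simp only: power_mult)
  qed
  finally show ?thesis by (simp add: fibre_sum_def sum_distrib_right)
qed

lemma dft_energy_p_multiples:
  "(\<Sum>k<N. dft c (p * k) * cnj (dft c (p * k))) = of_int (int N * (\<Sum>w<N. (fibre_sum c w)\<^sup>2))"
  using parseval_roots_of_unity[OF primitive_zeta_power_p, of "\<lambda>w. of_int (fibre_sum c w)"]
  unfolding dft_p_mult by (simp add: power2_eq_square)

lemma sum_totatives_plus_multiples:
  "(\<Sum>k<n. f k) = (\<Sum>k\<in>totatives n. f k) + (\<Sum>k<N. f (p * k))"
proof -
  have "{..<n} = totatives n \<union> (\<lambda>k. p * k) ` {..<N}" "totatives n \<inter> (\<lambda>k. p * k) ` {..<N} = {}"
    using p_gt_1 unfolding totatives_n by (auto simp: n_eq)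
  then have "(\<Sum>k<n. f k) = (\<Sum>k\<in>totatives n. f k) + (\<Sum>k\<in>(\<lambda>k. p * k) ` {..<N}. f k)"
    by (simp add: sum.union_disjoint)
  then show ?thesis using p_gt_1 by (simp add: sum.reindex inj_on_def)
qed

lemma sum_spread_fibres:
  "(\<Sum>w<N. spread c (fibre w)) = int p * (\<Sum>i<n. (c i)\<^sup>2) - (\<Sum>w<N. (fibre_sum c w)\<^sup>2)"
  by (simp add: spread_def card_fibre fibre_sum_def sum_subtractf flip: sum_fibres sum_distrib_left)

theorem trace_identity:
  assumes "weil_number m (dft c 1)"
  shows "(\<Sum>w<N. spread c (fibre w)) = (int p - 1) * int m"
proof -
  have "dft c k * cnj (dft c k) = of_nat m" if "k \<in> totatives n" for k
    using weil_number_gal[OF assms, of k] that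
    by (simp add: totatives_n gal_dft[unfolded One_nat_def] weil_number_mult_cnj)
  then have "(\<Sum>k\<in>totatives n. dft c k * cnj (dft c k)) = of_int (int (n - N) * int m)"
    by (simp add: card_totatives_n)
  then have "of_int (int n * (\<Sum>i<n. (c i)\<^sup>2)) =
      (of_int (int (n - N) * int m + int N * (\<Sum>w<N. (fibre_sum c w)\<^sup>2)) :: complex)"
    unfolding dft_energy[symmetric] of_int_add dft_energy_p_multiples[symmetric]
    by (simp add: sum_totatives_plus_multiples)
  then have "int n * (\<Sum>i<n. (c i)\<^sup>2) = int (n - N) * int m + int N * (\<Sum>w<N. (fibre_sum c w)\<^sup>2)"
    by (simp only: of_int_eq_iff)
  moreover have "int (n - N) = int N * (int p - 1)"
    using N_less_n by (simp add: n_eq of_nat_diff algebra_simps)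
  moreover have "int n = int N * int p" by (simp add: n_eq)
  ultimately have "int N * (\<Sum>w<N. spread c (fibre w)) = int N * ((int p - 1) * int m)"
    unfolding sum_spread_fibres by (simp add: algebra_simps)
  then show ?thesis using N_pos by simp
qed

lemma dft_eq_0_iff: "dft c 1 = 0 \<longleftrightarrow> (\<forall>i<n. c i = c (i mod N))"
proof
  assume "dft c 1 = 0"
  then have "weil_number 0 (dft c 1)" by (simp add: weil_number_def)
  then have "(\<Sum>w<N. spread c (fibre w)) = 0" by (simp add: trace_identity)
  then have "spread c (fibre w) = 0" if "w < N" for w
    using that by (simp add: sum_nonneg_eq_0_iff spread_nonneg)
  then have const: "c i = c j" if "w < N" "i \<in> fibre w" "j \<in> fibre w" for w i j
    using that by (metis finite_fibre spread_eq_0_iff)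
  show "\<forall>i<n. c i = c (i mod N)"
  proof (intro allI impI)
    fix i assume "i < n"
    then have "i \<in> fibre (i mod N)" by (simp add: fibre_def)
    then show "c i = c (i mod N)" using N_pos by (intro const[of "i mod N"]) simp_all
  qed
next
  assume const: "\<forall>i<n. c i = c (i mod N)"
  have "dft c 1 = dft (\<lambda>i. c (i mod N)) 1"
    unfolding dft_def using const by (intro sum.cong refl) (metis lessThan_iff)
  also have "\<dots> = 0" by (rule dft_fibre_const)
  finally show "dft c 1 = 0" .
qed

lemma of_nat_cdvd_iff: "of_nat k cdvd of_nat m \<longleftrightarrow> k dvd m"
proof
  assume "of_nat k cdvd of_nat m"
  then obtain x where x: "x \<in> R" "of_nat m = of_nat k * x" by (rule adjoin_dvdE)
  obtain c where c: "x = dft c 1" using ex_dft x(1) by blast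
  define d where "d i = (if i = 0 then int m else 0) - int k * c i" for i
  have "dft d 1 = (\<Sum>i<n. (if i = 0 then of_nat m else 0) - of_nat k * (of_int (c i) * \<zeta> ^ i))"
    unfolding dft_def d_def by (intro sum.cong) (auto simp: algebra_simps)
  also have "\<dots> = of_nat m - of_nat k * dft c 1"
    using n_pos by (simp add: sum_subtractf dft_def sum_distrib_left)
  finally have "dft d 1 = 0" using x c by simp
  then have "d N = d (N mod N)" using N_less_n by (simp only: dft_eq_0_iff)
  then have "int m = int k * (c 0 - c N)" using N_pos by (simp add: d_def algebra_simps)
  then have "int k dvd int m" by simp
  then show "k dvd m" by simp
qed (rule of_nat_adjoin_dvd)

subsection \<open>Balanced expansions\<close>

definition balanced :: "(nat \<Rightarrow> int) \<Rightarrow> bool" where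
  "balanced c \<longleftrightarrow> (\<forall>w<N. 2 * \<bar>fibre_sum c w\<bar> < int p)"

lemma balanced_unique:
  assumes "balanced c" "balanced d" "dft c 1 = dft d 1" "i < n"
  shows "c i = d i"
proof -
  define w where "w = i mod N"
  have w: "w < N" "i \<in> fibre w" using assms(4) N_pos by (simp_all add: w_def fibre_def)
  define e where "e i = c i - d i" for i
  have "dft e 1 = 0" using assms(3) by (simp add: e_def[abs_def] dft_diff)
  then have "e j = e i" if "j \<in> fibre w" for j
    using that w unfolding dft_eq_0_iff fibre_def by (metis (mono_tags, lifting) mem_Collect_eq)
  then have "(\<Sum>j\<in>fibre w. e j) = (\<Sum>j\<in>fibre w. e i)" by (intro sum.cong refl)
  then have "int p * e i = (\<Sum>j\<in>fibre w. e j)" using w by (simp add: card_fibre)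
  also have "\<dots> = fibre_sum c w - fibre_sum d w" by (simp add: e_def fibre_sum_def sum_subtractf)
  finally have "\<bar>int p * e i\<bar> < int p"
    using assms(1,2) w(1) unfolding balanced_def by fastforce
  then have "int p * \<bar>e i\<bar> < int p * 1" by (simp add: abs_mult)
  then have "\<bar>e i\<bar> < 1" unfolding mult_less_cancel_left by simp
  then show ?thesis by (simp add: e_def)
qed

end

context odd_prime_power_level
begin

lemma ex_balanced_dft:
  assumes "x \<in> R"
  obtains c where "balanced c" "x = dft c 1"
proof -
  obtain c where c: "x = dft c 1" using assms ex_dft by blast
  have "\<exists>v. 2 * \<bar>fibre_sum c w - int p * v\<bar> < int p" for w
    using ex_balancing_shift[of "int p"] odd_p p_gt_1 by auto
  then obtain v where v: "\<And>w. 2 * \<bar>fibre_sum c w - int p * v w\<bar> < int p" by metis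
  define d where "d i = c i - v (i mod N)" for i
  have "fibre_sum d w = fibre_sum c w - int p * v w" if "w < N" for w
  proof -
    have "fibre_sum d w = (\<Sum>i\<in>fibre w. c i - v w)"
      unfolding fibre_sum_def d_def by (intro sum.cong) (auto simp: fibre_def)
    then show ?thesis using that by (simp add: sum_subtractf fibre_sum_def card_fibre)
  qed
  then have "balanced d" using v by (simp add: balanced_def)
  moreover have "x = dft d 1"
    by (simp add: c d_def[abs_def] dft_diff dft_fibre_const[unfolded One_nat_def])
  ultimately show ?thesis by (rule that)
qed

lemma balanced_abs_fibre_sum_bound:
  assumes "balanced c" "weil_number m (dft c 1)"
  shows "(int p + 1) * (\<Sum>w<N. \<bar>fibre_sum c w\<bar>) \<le> 2 * ((int p - 1) * int m)"
proof -
  have "(\<Sum>w<N. (int p + 1) * \<bar>fibre_sum c w\<bar>) \<le> (\<Sum>w<N. 2 * spread c (fibre w))"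
  proof (rule sum_mono)
    show "(int p + 1) * \<bar>fibre_sum c w\<bar> \<le> 2 * spread c (fibre w)" if "w \<in> {..<N}" for w
      using spread_ge_abs_sum[of c "fibre w"] assms(1) that
      by (simp add: balanced_def fibre_sum_def card_fibre)
  qed
  then show ?thesis
    using trace_identity[OF assms(2)] by (simp flip: sum_distrib_left)
qed

theorem weil_number_1_imp_root_of_unity:
  assumes "weil_number 1 x"
  obtains e :: int and i where "\<bar>e\<bar> = 1" "x = of_int e * \<zeta> ^ i"
proof -
  obtain c where c: "balanced c" "x = dft c 1" using assms ex_balanced_dft weil_number_in_R by blast
  define A T where "A = (\<Sum>w<N. \<bar>fibre_sum c w\<bar>)" and "T = (\<Sum>w<N. (fibre_sum c w)\<^sup>2)"
  have "(int p + 1) * A \<le> 2 * (int p - 1)"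
    using balanced_abs_fibre_sum_bound[of c 1] assms c by (simp add: A_def)
  also have "\<dots> < (int p + 1) * 2" by simp
  finally have "A < 2" unfolding mult_less_cancel_left by simp
  moreover have "A \<ge> 0" unfolding A_def by (intro sum_nonneg) simp
  ultimately have "A\<^sup>2 \<le> 1" by (auto simp: abs_square_le_1)
  moreover have "T \<le> A\<^sup>2" "T \<ge> 0"
    unfolding T_def A_def by (rule sum_squares_le_square_sum_abs, simp, intro sum_nonneg, simp)
  moreover have energy: "int p * (\<Sum>i<n. (c i)\<^sup>2) = T + (int p - 1)"
    using trace_identity[of 1 c] assms c by (simp add: sum_spread_fibres T_def)
  have "T - 1 = int p * ((\<Sum>i<n. (c i)\<^sup>2) - 1)" using energy by (simp add: algebra_simps)
  then have "int p dvd T - 1" by simp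
  ultimately have "T = 1" using p_ge_3 zdvd_not_zless[of 1 "int p"] by (cases "T = 0") auto
  then have "int p * (\<Sum>i<n. (c i)\<^sup>2) = int p * 1" using energy by simp
  then have "(\<Sum>i<n. (c i)\<^sup>2) = 1" using p_gt_1 by simp
  then obtain i where i: "i < n" "\<bar>c i\<bar> = 1" "\<And>j. j \<in> {..<n} - {i} \<Longrightarrow> c j = 0"
    by (rule sum_squares_eq_1_imp_single[rotated]) auto
  then have "x = of_int (c i) * \<zeta> ^ i"
    by (simp add: c dft_def sum.remove[of "{..<n}" i])
  then show ?thesis using that i(2) by blast
qed

theorem weil_number_planar_bound:
  assumes x: "weil_number m x" and m: "\<not> is_square m"
  shows "p \<le> m\<^sup>2 + m + 1"
proof -
  have "m \<noteq> 0" "m \<noteq> 1" using m by (auto intro: ccontr)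
  obtain c where c: "balanced c" "x = dft c 1" using x ex_balanced_dft weil_number_in_R by blast
  define A E T S where "A = (\<Sum>w<N. \<bar>fibre_sum c w\<bar>)" and "E = (\<Sum>i<n. (c i)\<^sup>2)"
    and "T = (\<Sum>w<N. (fibre_sum c w)\<^sup>2)" and "S = (\<Sum>w<N. fibre_sum c w)"
  have "\<pi> cdvd (\<Sum>i<n. of_int (c i) * \<zeta> ^ i - of_int (c i))"
    by (intro adjoin_dvd_sum mult_zeta_power_cong_mod_pi) simp
  then have "\<pi> cdvd x - of_int S"
    by (simp add: c dft_def S_def fibre_sum_def sum_fibres sum_subtractf flip: of_int_sum)
  with x have S: "int p dvd S\<^sup>2 - int m" by (rule weil_number_cong_mod_pi)
  have "int p \<le> (int m)\<^sup>2 + int m + 1"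
  proof (rule planar_counting_bound)
    show "int m \<ge> 2" using \<open>m \<noteq> 0\<close> \<open>m \<noteq> 1\<close> by linarith
    show "int p * E - T = (int p - 1) * int m"
      using trace_identity[of m c] x c by (simp add: sum_spread_fibres E_def T_def)
    show "0 \<le> T" unfolding T_def by (intro sum_nonneg) simp
    show "T \<le> A\<^sup>2" unfolding T_def A_def by (rule sum_squares_le_square_sum_abs) simp
    show "0 \<le> A" unfolding A_def by (intro sum_nonneg) simp
    show "A \<le> E"
      unfolding A_def E_def sum_fibres[symmetric] fibre_sum_def
      by (intro sum_mono abs_sum_le_sum_squares)
    show "(int p + 1) * A \<le> 2 * ((int p - 1) * int m)"
      unfolding A_def using c x by (intro balanced_abs_fibre_sum_bound) auto
    show "\<bar>S\<bar> \<le> A" unfolding S_def A_def by (rule sum_abs)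
    show "S\<^sup>2 \<noteq> int m" using m is_square_if_int_square by blast
  qed (rule S)
  then have "int p \<le> int (m\<^sup>2 + m + 1)" by simp
  then show ?thesis by (simp only: of_nat_le_iff)
qed

end

section \<open>Primes different from p are unramified\<close>

context prime_power_level
begin

lemma not_p_dvd_prime: "prime q \<Longrightarrow> q \<noteq> p \<Longrightarrow> \<not> p dvd q"
  using prime_p primes_dvd_imp_eq by blast

lemma frobenius_cong:
  assumes "prime q" "q \<noteq> p" "x \<in> R"
  shows "of_nat q cdvd gal q x - x ^ q"
proof -
  obtain P where P: "x = ipoly P \<zeta>" using assms(3) by (rule int_adjoinE)
  have "of_nat q cdvd ipoly (P ^ q - P \<circ>\<^sub>p monom 1 q) \<zeta>"
    using assms(1) by (intro of_nat_adjoin_dvd_ipoly prime_dvd_frobenius_poly)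
  from adjoin_dvd_minus[OF this] show ?thesis
    using not_p_dvd_prime[OF assms(1,2)] by (simp add: P)
qed

lemma frobenius_iterated_cong:
  assumes q: "prime q" "q \<noteq> p" and x: "x \<in> R"
  shows "of_nat q cdvd gal (q ^ k) x - x ^ q ^ k"
proof (induction k)
  case (Suc k)
  have "\<not> p dvd q" using q by (rule not_p_dvd_prime)
  define y where "y = gal (q ^ k) x"
  have y: "y \<in> R" using x \<open>\<not> p dvd q\<close> by (simp add: y_def not_p_dvd_power)
  have "of_nat q cdvd y ^ q - (x ^ q ^ k) ^ q"
    using Suc x y unfolding y_def by (intro adjoin_dvd_power_diff) auto
  with frobenius_cong[OF q y] have "of_nat q cdvd (gal q y - y ^ q) + (y ^ q - (x ^ q ^ k) ^ q)"
    by (rule adjoin_dvd_add)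
  then show ?case
    using x \<open>\<not> p dvd q\<close> by (simp add: y_def not_p_dvd_power mult.commute flip: power_mult)
qed (use x in simp)

lemma ex_large_power_cong_1:
  assumes "\<not> p dvd q"
  obtains l where "l > a" "[q ^ l = 1] (mod n)"
proof -
  have "ord n q > 0" using assms by (simp add: coprime_n_iff coprime_commute)
  then have "ord n q * Suc a > a" by (cases "ord n q") auto
  moreover have "[q ^ (ord n q * Suc a) = 1] (mod n)" unfolding ord_divides by (rule dvd_triv_left)
  ultimately show ?thesis by (rule that)
qed

lemma power_fixed_by_frobenius_cong:
  assumes q: "prime q" "q \<noteq> p" and x: "x \<in> R" and l: "[q ^ l = 1] (mod n)"
  shows "of_nat q cdvd x - x ^ q ^ l"
  using frobenius_iterated_cong[OF q x, of l] gal_cong[OF l, of x] x by simp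

lemma frobenius_cong_lifted:
  assumes q: "prime q" "q \<noteq> p" and x: "x \<in> R"
  shows "of_nat (q ^ Suc k) cdvd gal q x ^ q ^ k - x ^ (q * q ^ k)"
  unfolding power_mult using x by (intro adjoin_dvd_power_prime_power frobenius_cong q) simp_all

text \<open>
  Induction on \<open>a\<close>: for \<open>Q = q ^ l\<close> with \<open>q ^ l \<equiv> 1\<close> modulo \<open>n\<close>, the difference \<open>x - x ^ Q\<close> is a
  multiple of \<open>q\<close>, so the hypothesis for \<open>a\<close> applies to the quotient. The remaining term is
  controlled by \<open>gal q x ^ Q \<equiv> x ^ (q * Q)\<close> modulo \<open>q ^ (l + 1)\<close>.
\<close>

lemma prime_power_cdvd_gal_mult:
  assumes q: "prime q" "q \<noteq> p" and z: "z \<in> R"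
  shows "x \<in> R \<Longrightarrow> of_nat (q ^ a) cdvd x * z \<Longrightarrow> of_nat (q ^ a) cdvd gal q x * z"
proof (induction a arbitrary: x)
  case 0
  have "gal q x \<in> R" using 0 not_p_dvd_prime[OF q] by simp
  then show ?case using z by (simp add: adjoin_dvd_def)
next
  case (Suc a)
  note x = \<open>x \<in> R\<close>
  have "\<not> p dvd q" "q \<noteq> 0" using q not_p_dvd_prime by auto
  obtain l where l: "l > a" "[q ^ l = 1] (mod n)"
    using ex_large_power_cong_1[OF \<open>\<not> p dvd q\<close>] by blast
  define Q where "Q = q ^ l"
  have "Q > 0" using \<open>q \<noteq> 0\<close> by (simp add: Q_def)
  obtain y where y: "y \<in> R" "x - x ^ Q = of_nat q * y"
    unfolding Q_def using power_fixed_by_frobenius_cong[OF q x l(2)] by (rule adjoin_dvdE)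
  have "of_nat (q ^ Suc a) cdvd (x - x ^ Q) * z"
    unfolding left_diff_distrib
    using Suc.prems \<open>Q > 0\<close> by (intro adjoin_dvd_diff adjoin_dvd_power_mult)
  then have "of_nat q * of_nat (q ^ a) cdvd of_nat q * (y * z)" by (simp add: y mult.assoc)
  then have "of_nat (q ^ a) cdvd y * z"
    using \<open>q \<noteq> 0\<close> by (subst (asm) adjoin_dvd_mult_cancel_left) auto
  then have "of_nat (q ^ a) cdvd gal q y * z" using y(1) by (intro Suc.IH)
  then have "of_nat (q ^ Suc a) cdvd of_nat q * (gal q y * z)" by (simp add: adjoin_dvd_mult_mono)
  moreover have "gal q x - gal q x ^ Q = of_nat q * gal q y"
    using arg_cong[OF y(2), of "gal q"] x y(1) \<open>\<not> p dvd q\<close> by simp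
  ultimately have quotient: "of_nat (q ^ Suc a) cdvd (gal q x - gal q x ^ Q) * z"
    by (simp only: mult.assoc)
  have "(of_nat (q ^ Suc a) :: complex) cdvd of_nat (q ^ Suc l)"
    using l(1) by (intro of_nat_adjoin_dvd le_imp_power_dvd) simp
  then have "of_nat (q ^ Suc a) cdvd gal q x ^ Q - x ^ (q * Q)"
    unfolding Q_def using frobenius_cong_lifted[OF q x] by (rule adjoin_dvd_trans)
  then have remainder: "of_nat (q ^ Suc a) cdvd (gal q x ^ Q - x ^ (q * Q)) * z"
    using z by (rule adjoin_dvd_mult_right)
  have "of_nat (q ^ Suc a) cdvd x ^ (q * Q) * z"
    using Suc.prems \<open>q \<noteq> 0\<close> \<open>Q > 0\<close> by (intro adjoin_dvd_power_mult) simp_all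
  with quotient remainder have "of_nat (q ^ Suc a) cdvd
      (gal q x - gal q x ^ Q) * z + ((gal q x ^ Q - x ^ (q * Q)) * z + x ^ (q * Q) * z)"
    by (intro adjoin_dvd_add)
  then show ?case by (simp add: algebra_simps)
qed

lemma prime_power_cdvd_gal_power_mult:
  assumes q: "prime q" "q \<noteq> p" and z: "z \<in> R" and x: "x \<in> R" "of_nat (q ^ a) cdvd x * z"
  shows "of_nat (q ^ a) cdvd gal (q ^ j) x * z"
proof (induction j)
  case (Suc j)
  have "\<not> p dvd q" using q by (rule not_p_dvd_prime)
  then show ?case
    using prime_power_cdvd_gal_mult[OF q z _ Suc] x(1) by (simp add: not_p_dvd_power)
qed (use x in simp)

lemma prime_cdvd_square_imp:
  assumes q: "prime q" "q \<noteq> p" and x: "x \<in> R" "of_nat q cdvd x\<^sup>2"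
  shows "of_nat q cdvd x"
proof -
  obtain l where l: "l > 0" "[q ^ l = 1] (mod n)"
    using ex_large_power_cong_1 not_p_dvd_prime[OF q] by blast
  have "q \<le> q ^ l" using l(1) prime_gt_0_nat[OF q(1)] by (simp add: self_le_power)
  then have "2 \<le> q ^ l" using prime_ge_2_nat[OF q(1)] by linarith
  then have "x ^ q ^ l = x\<^sup>2 * x ^ (q ^ l - 2)"
    using power_add[of x 2 "q ^ l - 2"] by (simp only: le_add_diff_inverse)
  then have "of_nat q cdvd x ^ q ^ l" using x by (simp add: adjoin_dvd_mult_right)
  with power_fixed_by_frobenius_cong[OF q x(1) l(2)]
  have "of_nat q cdvd (x - x ^ q ^ l) + x ^ q ^ l"
    by (rule adjoin_dvd_add)
  then show ?thesis by simp
qed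

lemma weil_number_divide_self_conjugate_prime:
  assumes x: "weil_number m x" and q: "prime q" "q \<noteq> p" "q dvd m"
    and j: "[q ^ j = n - 1] (mod n)"
  obtains k y where "m = q\<^sup>2 * k" "weil_number k y"
proof -
  have xR: "x \<in> R" using x by simp
  have "of_nat (q ^ 1) cdvd x * cnj x"
    using q(3) x by (simp add: weil_number_mult_cnj of_nat_adjoin_dvd)
  then have "of_nat (q ^ 1) cdvd gal (q ^ j) x * cnj x"
    using xR by (intro prime_power_cdvd_gal_power_mult q) auto
  then have "of_nat q cdvd (cnj x)\<^sup>2"
    using gal_cong[OF j, of x] xR by (simp add: cnj_eq_gal power2_eq_square)
  then have "of_nat q cdvd cnj x" using prime_cdvd_square_imp[OF q(1,2) cnj_in_R[OF xR]] by blast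
  then obtain y where y: "y \<in> R" "cnj x = of_nat q * y" by (rule adjoin_dvdE)
  then have "x = of_nat q * cnj y" by (metis complex_cnj_cnj complex_cnj_mult complex_cnj_of_nat)
  then have m: "of_nat m = of_nat (q\<^sup>2) * (y * cnj y)"
    using weil_number_mult_cnj[OF x] y(2) by (simp add: power2_eq_square mult_ac)
  then have "of_nat (q\<^sup>2) cdvd of_nat m" by (rule adjoin_dvdI) (use y in simp)
  then obtain k where k: "m = q\<^sup>2 * k" unfolding of_nat_cdvd_iff by (rule dvdE)
  then have "weil_number k y" using m y(1) prime_gt_0_nat[OF q(1)] by (simp add: weil_number_def)
  with k show ?thesis by (rule that)
qed

lemma weil_number_even_multiplicity:
  assumes "weil_number m x" "m > 0" and q: "prime q" "q \<noteq> p" and j: "[q ^ j = n - 1] (mod n)"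
  shows "even (multiplicity q m)"
  using assms(1,2)
proof (induction m arbitrary: x rule: less_induct)
  case (less m)
  show ?case
  proof (cases "q dvd m")
    case True
    obtain k y where k: "m = q\<^sup>2 * k" "weil_number k y"
      using weil_number_divide_self_conjugate_prime[OF less.prems(1) q True j] by blast
    have "k > 0" using less.prems k by (cases k) auto
    moreover have "q\<^sup>2 > 1" using prime_gt_1_nat[OF q(1)] by (rule one_less_power) simp
    ultimately have "even (multiplicity q k)" using less.IH[of k y] k by simp
    moreover have "multiplicity q m = 2 + multiplicity q k"
      unfolding k(1) using q(1) \<open>k > 0\<close> by (subst prime_elem_multiplicity_mult_distrib) auto
    ultimately show ?thesis by simp
  qed (simp add: not_dvd_imp_multiplicity_0)
qed

lemma ex_affine_fixed_point:
  assumes "\<not> [t = 1] (mod p)" "t > 0"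
  obtains k where "[t * k + i = k] (mod n)"
proof -
  have "\<not> p dvd t - 1" using assms by (simp add: cong_altdef_nat)
  then obtain x where x: "[(t - 1) * x = 1] (mod n)" by (rule ex_inverse_mod_n)
  define k where "k = x * (i * (n - 1))"
  have "t * k + i = k + (t - 1) * k + i" using assms(2) by (cases t) simp_all
  also have "(t - 1) * k = ((t - 1) * x) * (i * (n - 1))" by (simp add: k_def mult.assoc)
  also have "[k + ((t - 1) * x) * (i * (n - 1)) + i = k + 1 * (i * (n - 1)) + i] (mod n)"
    using x by (intro cong_add cong_mult cong_refl)
  also have "k + 1 * (i * (n - 1)) + i = k + i * n" using n_pos by (cases n) auto
  also have "[k + i * n = k] (mod n)" by (simp add: cong_def)
  finally show ?thesis by (rule that)
qed

lemma gal_power_eigen: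
  assumes "x \<in> R" "\<not> p dvd t" "gal t x = of_int e * x"
  shows "gal (t ^ j) x = of_int e ^ j * x"
proof (induction j)
  case (Suc j)
  have "gal (t ^ Suc j) x = gal t (gal (t ^ j) x)" using assms by (simp add: not_p_dvd_power)
  also have "\<dots> = gal t (of_int (e ^ j) * x)" using Suc by simp
  also have "\<dots> = of_int (e ^ j) * gal t x" using assms by (simp del: of_int_power)
  finally show ?case using assms(3) by (simp add: mult_ac)
qed (use assms in simp)

lemma weil_number_normalise:
  assumes x: "weil_number m x" "m > 0"
    and t: "\<not> p dvd t" "\<not> [t = 1] (mod p)" "[t ^ f = 1] (mod n)" "odd f"
    and gal: "gal t x = of_int e * \<zeta> ^ i * x" "\<bar>e\<bar> = 1"
  obtains y where "weil_number m y" "gal t y = y"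
proof -
  have "t > 0" using t(1) by (intro gr0I) auto
  with t(2) obtain k where k: "[t * k + i = k] (mod n)" by (rule ex_affine_fixed_point)
  define y where "y = \<zeta> ^ k * x"
  have y: "weil_number m y"
    using weil_number_mult[OF weil_number_zeta_power x(1)] by (simp add: y_def)
  have "gal t y = of_int e * (\<zeta> ^ (t * k + i) * x)"
    using x t(1) gal(1) by (simp add: y_def power_add mult_ac flip: power_mult)
  also have "\<zeta> ^ (t * k + i) = \<zeta> ^ k" using k by (simp only: zeta_power_eq_iff)
  finally have eigen: "gal t y = of_int e * y" by (simp add: y_def)
  have "y \<noteq> 0" using weil_number_mult_cnj[OF y] x(2) by auto
  moreover have "y = of_int e ^ f * y"
    using gal_power_eigen[OF _ t(1) eigen, of f] gal_cong[OF t(3), of y] y by simp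
  ultimately have "(of_int (e ^ f) :: complex) = of_int 1" by simp
  then have "e ^ f = 1" by (simp only: of_int_eq_iff)
  then have "e = 1" using gal(2) t(4) by (auto simp: abs_if split: if_splits)
  then show ?thesis using that y eigen by simp
qed

end

context odd_prime_power_level
begin

lemma weil_number_gal_eq_root_of_unity_mult:
  assumes x: "weil_number m x" and m: "m > 0" "\<not> p dvd m" and t: "\<not> p dvd t"
    and decomposition: "\<And>q. q \<in> prime_factors m \<Longrightarrow> \<exists>j. [t = q ^ j] (mod n)"
  obtains e :: int and i where "\<bar>e\<bar> = 1" "gal t x = of_int e * \<zeta> ^ i * x"
proof -
  have xR: "x \<in> R" using x by simp
  have "of_nat m cdvd gal t x * cnj x"
  proof (rule of_nat_adjoin_dvd_if_prime_powers)
    fix q assume q: "q \<in> prime_factors m"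
    obtain j where "[t = q ^ j] (mod n)" using decomposition[OF q] by blast
    then have "gal t x = gal (q ^ j) x" by (rule gal_cong)
    moreover have "(of_nat (q ^ multiplicity q m) :: complex) cdvd x * cnj x"
      using x
      by (simp add: weil_number_mult_cnj of_nat_adjoin_dvd multiplicity_dvd del: of_nat_power)
    ultimately show "of_nat (q ^ multiplicity q m) cdvd gal t x * cnj x"
      using xR q m
      by (auto intro!: prime_power_cdvd_gal_power_mult simp: in_prime_factors_iff
          simp del: of_nat_power)
  qed (use m xR t in simp_all)
  then obtain u where u: "u \<in> R" "gal t x * cnj x = of_nat m * u" by (rule adjoin_dvdE)
  have "weil_number (m * m) (of_nat m * u)"
    unfolding u(2)[symmetric] using x t by (intro weil_number_mult weil_number_gal weil_number_cnj)
  then have "weil_number 1 u" using m u(1) by (simp add: weil_number_def)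
  then obtain e :: int and i where e: "\<bar>e\<bar> = 1" "u = of_int e * \<zeta> ^ i"
    by (rule weil_number_1_imp_root_of_unity)
  have "of_nat m * gal t x = gal t x * cnj x * x"
    using x by (simp add: mult.commute mult.left_commute flip: weil_number_mult_cnj)
  also have "\<dots> = of_nat m * (u * x)" by (simp add: u(2))
  finally have "gal t x = u * x" using m by simp
  then show ?thesis by (intro that[OF e(1)]) (simp only: e(2))
qed

end

section \<open>Orbits of a fixing automorphism\<close>

lemma bij_betw_mult_mod:
  fixes t n :: nat
  assumes "coprime t n" "n > 0"
  shows "bij_betw (\<lambda>i. t * i mod n) {..<n} {..<n}"
proof -
  have "inj_on (\<lambda>i. t * i mod n) {..<n}"
  proof (rule inj_onI)
    fix i j assume ij: "i \<in> {..<n}" "j \<in> {..<n}" "t * i mod n = t * j mod n"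
    then have "[t * i = t * j] (mod n)" by (simp add: cong_def)
    then have "[i = j] (mod n)" using assms(1) by (simp add: cong_mult_lcancel_nat)
    then show "i = j" using ij by (simp add: cong_def)
  qed
  moreover have "(\<lambda>i. t * i mod n) ` {..<n} \<subseteq> {..<n}" using assms(2) by auto
  ultimately show ?thesis by (simp add: bij_betw_def endo_inj_surj)
qed

lemma inj_on_orbit_mod_prime_power:
  fixes p t x r :: nat
  assumes p: "prime p" and x: "\<not> p ^ r dvd x"
  shows "inj_on (\<lambda>j. t ^ j * x mod p ^ r) {..<ord p t}"
proof (rule inj_onI)
  fix i j
  assume ij: "i \<in> {..<ord p t}" "j \<in> {..<ord p t}" "t ^ i * x mod p ^ r = t ^ j * x mod p ^ r"
  define d where "d = int (t ^ i) - int (t ^ j)"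
  have "[t ^ i * x = t ^ j * x] (mod p ^ r)" using ij(3) by (simp add: cong_def)
  then have "int (p ^ r) dvd int (t ^ i * x) - int (t ^ j * x)"
    by (simp only: cong_iff_dvd_diff flip: cong_int_iff)
  then have "int (p ^ r) dvd d * int x" by (simp add: d_def left_diff_distrib)
  moreover have "\<not> int (p ^ r) dvd int x" unfolding int_dvd_int_iff by (rule x)
  ultimately have "\<not> coprime (int (p ^ r)) d" using coprime_dvd_mult_right_iff by blast
  then have "\<not> coprime (int p) d" by (auto simp: coprime_power_left_iff)
  then have "int p dvd d" using p by (meson prime_imp_coprime prime_nat_int_transfer)
  then have "t ^ i mod p = t ^ j mod p"
    unfolding d_def cong_iff_dvd_diff[symmetric] cong_int_iff by (simp only: cong_def)
  moreover have "coprime p t" using ij(1) ord_eq_0[of p t] by auto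
  ultimately show "i = j" using ij(1,2) inj_power_mod by (meson inj_onD)
qed

context prime_power_level
begin

lemma gal_eq_0_imp:
  assumes x: "x \<in> R" "gal k x = 0" and k: "\<not> p dvd k"
  shows "x = 0"
proof -
  obtain l where l: "[k * l = 1] (mod n)" "\<not> p dvd l" using k by (rule ex_inverse_mod_n)
  then have "gal l (gal k x) = x" using x(1) k gal_cong[OF l(1), of x] by (simp add: mult.commute)
  moreover have "gal l 0 = 0" using gal_of_int[OF l(2), of 0] by simp
  ultimately show ?thesis using x(2) by simp
qed

lemma bij_betw_fibre_mult:
  assumes t: "\<not> p dvd t" and w: "w < N"
  shows "bij_betw (\<lambda>i. t * i mod n) (fibre w) (fibre (t * w mod N))"
proof -
  have "inj_on (\<lambda>i. t * i mod n) {..<n}"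
    using bij_betw_mult_mod[of t n] t n_pos by (simp add: coprime_n_iff bij_betw_def)
  then have inj: "inj_on (\<lambda>i. t * i mod n) (fibre w)"
    by (rule inj_on_subset) (auto simp: fibre_def)
  have "(\<lambda>i. t * i mod n) ` fibre w = fibre (t * w mod N)"
  proof (rule card_subset_eq)
    show "(\<lambda>i. t * i mod n) ` fibre w \<subseteq> fibre (t * w mod N)"
      using n_pos by (auto simp: fibre_def n_eq mod_mod_cancel mod_mult_right_eq)
    show "card ((\<lambda>i. t * i mod n) ` fibre w) = card (fibre (t * w mod N))"
      using inj w N_pos by (simp add: card_image card_fibre)
  qed simp
  with inj show ?thesis by (simp add: bij_betw_def)
qed

lemma balanced_mult:
  assumes c: "balanced c" and t: "\<not> p dvd t"
  shows "balanced (\<lambda>i. c (t * i mod n))"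
  unfolding balanced_def
proof (intro allI impI)
  fix w assume "w < N"
  then have "fibre_sum (\<lambda>i. c (t * i mod n)) w = fibre_sum c (t * w mod N)"
    unfolding fibre_sum_def using t by (intro sum.reindex_bij_betw bij_betw_fibre_mult)
  then show "2 * \<bar>fibre_sum (\<lambda>i. c (t * i mod n)) w\<bar> < int p"
    using c N_pos by (simp add: balanced_def)
qed

lemma balanced_fixed_imp_invariant:
  assumes c: "balanced c" and t: "\<not> p dvd t" and fixed: "gal t (dft c 1) = dft c 1" and "i < n"
  shows "c (t * i mod n) = c i"
proof -
  define d where "d i = c (t * i mod n)" for i
  have "dft d t = (\<Sum>i<n. of_int (c (t * i mod n)) * \<zeta> ^ (t * i mod n))"
    by (simp add: dft_def d_def zeta_power_mod mult.commute)
  also have "\<dots> = dft c 1"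
    using sum.reindex_bij_betw[OF bij_betw_mult_mod, of t n "\<lambda>i. of_int (c i) * \<zeta> ^ i"] t n_pos
    by (simp add: dft_def coprime_n_iff)
  also have "\<dots> = dft c t" unfolding gal_dft[OF t, symmetric] using fixed by (rule sym)
  finally have "gal t (dft d 1 - dft c 1) = 0" using t by (simp add: gal_dft[unfolded One_nat_def])
  then have "dft d 1 - dft c 1 = 0" by (rule gal_eq_0_imp[rotated]) (simp_all add: t)
  then have "dft d 1 = dft c 1" by simp
  moreover have "balanced d" unfolding d_def using c t by (rule balanced_mult)
  ultimately have "d i = c i" using c \<open>i < n\<close> by (intro balanced_unique)
  then show ?thesis by (simp add: d_def)
qed

lemma balanced_fixed_imp_orbit_invariant:
  assumes "balanced c" "\<not> p dvd t" "gal t (dft c 1) = dft c 1" "i < n"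
  shows "c (t ^ j * i mod n) = c i"
proof -
  have "gal (t ^ j) (dft c 1) = dft c 1"
    using gal_power_eigen[of "dft c 1" t 1 j] assms(2,3) by simp
  then show ?thesis using assms by (intro balanced_fixed_imp_invariant not_p_dvd_power)
qed

lemma spread_orbit_invariant:
  assumes "balanced c" "\<not> p dvd t" "gal t (dft c 1) = dft c 1" "w < N"
  shows "spread c (fibre (t ^ j * w mod N)) = spread c (fibre w)"
proof -
  have "spread c (fibre (t ^ j * w mod N)) = spread (\<lambda>i. c (t ^ j * i mod n)) (fibre w)"
    using assms by (intro spread_reindex bij_betw_fibre_mult not_p_dvd_power)
  also have "\<dots> = spread c (fibre w)"
    using balanced_fixed_imp_orbit_invariant[OF assms(1-3)] by (simp add: spread_def fibre_def)
  finally show ?thesis .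
qed

lemma spread_eq_0_off_zero_fibre:
  assumes c: "balanced c" "weil_number m (dft c 1)" "gal t (dft c 1) = dft c 1"
    and t: "\<not> p dvd t" "m < ord p t" and w: "w < N" "w \<noteq> 0"
  shows "spread c (fibre w) = 0"
proof (rule ccontr)
  assume nonzero: "spread c (fibre w) \<noteq> 0"
  have inj: "inj_on (\<lambda>j. t ^ j * w mod N) {..<ord p t}"
    using w prime_p unfolding N_def by (intro inj_on_orbit_mod_prime_power) (auto dest: dvd_imp_le)
  have "int (ord p t) * (int p - 1) = (\<Sum>j<ord p t. int p - 1)" by simp
  also have "\<dots> \<le> (\<Sum>j<ord p t. spread c (fibre (t ^ j * w mod N)))"
  proof (rule sum_mono)
    show "int p - 1 \<le> spread c (fibre (t ^ j * w mod N))" for j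
      using spread_ge_card_minus_1[OF finite_fibre nonzero] w c t
      by (simp add: spread_orbit_invariant card_fibre)
  qed
  also have "\<dots> = (\<Sum>v\<in>(\<lambda>j. t ^ j * w mod N) ` {..<ord p t}. spread c (fibre v))"
    by (simp add: sum.reindex[OF inj])
  also have "\<dots> \<le> (\<Sum>v<N. spread c (fibre v))"
    using N_pos by (intro sum_mono2) (auto intro: spread_nonneg)
  also have "\<dots> = int m * (int p - 1)" using trace_identity[OF c(2)] by simp
  finally show False using t(2) p_gt_1 by simp
qed

lemma ord_le_card_orbit_invariant:
  assumes i: "i \<in> fibre 0" "i \<noteq> 0" and A: "finite A" "\<And>j. t ^ j * i mod n \<in> A"
  shows "ord p t \<le> card A"
proof -
  have "\<not> p ^ b dvd i" using i by (auto simp: fibre_def n_def dest: dvd_imp_le)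
  then have "inj_on (\<lambda>j. t ^ j * i mod n) {..<ord p t}"
    unfolding n_def using prime_p by (intro inj_on_orbit_mod_prime_power)
  then have "ord p t = card ((\<lambda>j. t ^ j * i mod n) ` {..<ord p t})" by (simp add: card_image)
  also have "\<dots> \<le> card A" using A by (intro card_mono) auto
  finally show ?thesis .
qed

lemma spread_zero_fibre_ge:
  assumes c: "balanced c" "gal t (dft c 1) = dft c 1" and t: "\<not> p dvd t"
    and ij: "i \<in> fibre 0 - {0}" "j \<in> fibre 0 - {0}" "c i \<noteq> c j"
  shows "int (ord p t) * (int p - int (ord p t)) \<le> spread c (fibre 0)"
proof -
  have "ord p t \<le> card {x \<in> fibre 0. c x = c k}" if k: "k \<in> fibre 0 - {0}" for k
  proof (rule ord_le_card_orbit_invariant)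
    fix l
    have "c (t ^ l * k mod n) = c k"
      using k c t by (intro balanced_fixed_imp_orbit_invariant) (auto simp: fibre_def)
    then show "t ^ l * k mod n \<in> {x \<in> fibre 0. c x = c k}"
      using k n_pos by (auto simp: fibre_def n_eq mod_mod_cancel)
  qed (use k in auto)
  from spread_ge_two_classes[OF finite_fibre ij(3) this[OF ij(1)] this[OF ij(2)]]
  show ?thesis using N_pos by (simp add: card_fibre)
qed

end

context odd_prime_power_level
begin

theorem weil_number_orbit_bound:
  assumes x: "weil_number m x" "gal t x = x" and m: "\<not> is_square m"
    and t: "\<not> p dvd t" "m < ord p t"
  shows "int (ord p t) * (int p - int (ord p t)) \<le> (int p - 1) * int m"
proof -
  obtain c where c: "balanced c" "x = dft c 1" using x(1) ex_balanced_dft weil_number_in_R by blast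
  have "(\<Sum>w<N. spread c (fibre w)) = spread c (fibre 0) + (\<Sum>w\<in>{..<N} - {0}. spread c (fibre w))"
    using N_pos by (simp add: sum.remove)
  also have "(\<Sum>w\<in>{..<N} - {0}. spread c (fibre w)) = 0"
    using c x t by (intro sum.neutral ballI spread_eq_0_off_zero_fibre) auto
  finally have total: "spread c (fibre 0) = (int p - 1) * int m"
    using trace_identity[of m c] c x by simp
  show ?thesis
  proof (cases "\<exists>i\<in>fibre 0 - {0}. \<exists>j\<in>fibre 0 - {0}. c i \<noteq> c j")
    case True
    then obtain i j where ij: "i \<in> fibre 0 - {0}" "j \<in> fibre 0 - {0}" "c i \<noteq> c j" by blast
    have "gal t (dft c 1) = dft c 1" using c x by simp
    from spread_zero_fibre_ge[OF c(1) this t(1) ij] show ?thesis unfolding total .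
  next
    case False
    have "card (fibre 0 - {0}) > 0" using N_pos p_gt_1 by (simp add: card_fibre)
    then obtain i where "i \<in> fibre 0 - {0}" by (metis card_gt_0_iff ex_in_conv)
    with False have "\<And>j. j \<in> fibre 0 - {0} \<Longrightarrow> c j = c i" by blast
    from spread_one_off[of "fibre 0" 0, OF _ _ this]
    have "(int p - 1) * (c 0 - c i)\<^sup>2 = (int p - 1) * int m"
      using total N_pos by (simp add: card_fibre)
    then have "(c 0 - c i)\<^sup>2 = int m" using p_gt_1 by simp
    then show ?thesis using m is_square_if_int_square by blast
  qed
qed

end

section \<open>Powers modulo a prime power\<close>

lemma residue_primroot_power_if_ord_dvd:
  assumes r: "residue_primroot n r" and "n > 1" and st: "coprime n s" "coprime n t"
    and dvd: "ord n t dvd ord n s"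
  obtains j where "[t = s ^ j] (mod n)"
proof -
  have rn: "coprime n r" "ord n r = totient n" using r by (auto simp: residue_primroot_def)
  have log: "\<exists>e. [u = r ^ e] (mod n)" if "coprime n u" for u
  proof -
    have "u mod n \<in> totatives n"
      using that \<open>n > 1\<close> by (auto simp: in_totatives_iff coprime_commute intro!: gr0I)
    then obtain e where "u mod n = r ^ e mod n"
      using residue_primroot_is_generator[OF \<open>n > 1\<close> r] by (force simp: bij_betw_def)
    then show ?thesis by (auto simp: cong_def)
  qed
  obtain e where e: "[s = r ^ e] (mod n)" using log st(1) by blast
  obtain h where h: "[t = r ^ h] (mod n)" using log st(2) by blast
  have gcd_s: "ord n s * gcd e (totient n) = totient n"
    and gcd_t: "ord n t * gcd h (totient n) = totient n"
    using ord_power_aux[of n r] rn(2) ord_cong[OF e] ord_cong[OF h] by simp_all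
  obtain u where "ord n s = ord n t * u" using dvd by (rule dvdE)
  with gcd_s gcd_t have "ord n t * (u * gcd e (totient n)) = ord n t * gcd h (totient n)"
    by (simp add: mult.assoc)
  then have "gcd h (totient n) = u * gcd e (totient n)"
    using st(2) ord_eq_0[of n t] by simp
  then have "gcd e (totient n) dvd h" by (metis dvd_triv_right gcd_dvd1 dvd_trans)
  then obtain v where v: "h = gcd e (totient n) * v" by (rule dvdE)
  obtain x where "[e * x = gcd e (totient n)] (mod totient n)" using cong_solve_nat by blast
  then have "[e * (x * v) = h] (mod totient n)"
    unfolding v mult.assoc[symmetric] by (rule cong_scalar_right)
  then have "[(r ^ e) ^ (x * v) = r ^ h] (mod n)"
    by (simp add: order_divides_expdiff[OF rn(1)] rn(2) flip: power_mult)
  moreover have "[s ^ (x * v) = (r ^ e) ^ (x * v)] (mod n)" using e by (rule cong_pow)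
  ultimately show ?thesis using h that by (meson cong_sym cong_trans)
qed

lemma ex_ord_eq_if_residue_primroot:
  assumes "residue_primroot n r" "f dvd totient n" "f > 0"
  obtains t where "coprime n t" "ord n t = f"
proof -
  have r: "coprime n r" "ord n r = totient n" using assms(1) by (auto simp: residue_primroot_def)
  obtain h where h: "totient n = f * h" using assms(2) by (rule dvdE)
  have "totient n > 0" using r by (metis ord_gt_0_iff)
  then have "h > 0" using h by (intro gr0I) auto
  have "ord n (r ^ h) = totient n div gcd h (totient n)" using r by (simp add: ord_power)
  also have "gcd h (totient n) = h" by (simp add: h)
  finally have "ord n (r ^ h) = f" using \<open>h > 0\<close> by (simp add: h)
  then show ?thesis using that[of "r ^ h"] r(1) by simp
qed

context prime_power_level
begin

lemma cong_power_N:
  assumes "[x = y] (mod p)"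
  shows "[x ^ N = y ^ N] (mod n)"
proof -
  have "of_nat p dvd int x - int y" using assms by (simp add: cong_iff_dvd_diff flip: cong_int_iff)
  from power_prime_power_cong[OF this, of "b - 1"] have "int n dvd int x ^ N - int y ^ N"
    using b_pos by (simp add: n_def N_def)
  then show ?thesis by (simp add: cong_iff_dvd_diff flip: cong_int_iff)
qed

lemma ord_p_dvd_ord_n: "ord p q dvd ord n q"
proof -
  have "[q ^ ord n q = 1] (mod p)" using ord[of q n] n_eq by (metis cong_modulus_mult_nat)
  then show ?thesis by (simp only: ord_divides)
qed

lemma ord_n_dvd_ord_p_mult_N: "ord n q dvd ord p q * N"
proof -
  have "[(q ^ ord p q) ^ N = 1 ^ N] (mod n)" by (intro cong_power_N ord)
  then show ?thesis by (simp add: ord_divides' flip: power_mult)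
qed

lemma ord_p_dvd_p_minus_1: "\<not> p dvd q \<Longrightarrow> ord p q dvd p - 1"
  using order_divides_totient[of p q] prime_imp_coprime[of p q] prime_p by (simp add: totient_prime)

end

context odd_prime_power_level
begin

lemma ex_residue_primroot: "\<exists>r. residue_primroot n r"
  using residue_primroot_odd_prime_power_exists[OF prime_p odd_p] b_pos unfolding n_def by metis

lemma ex_common_power_of_order:
  assumes "f > 0" "Q \<noteq> {}" and Q: "\<And>q. q \<in> Q \<Longrightarrow> \<not> p dvd q \<and> f dvd ord p q"
  obtains t where "\<not> p dvd t" "ord p t = f" "ord n t = f" "\<And>q. q \<in> Q \<Longrightarrow> \<exists>j. [t = q ^ j] (mod n)"
proof -
  obtain r where r: "residue_primroot n r" using ex_residue_primroot by blast
  have f: "f dvd p - 1" using assms(2) Q ord_p_dvd_p_minus_1 dvd_trans by blast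
  moreover have "totient n = (p - 1) * N" unfolding totient_n by (simp add: n_eq diff_mult_distrib)
  ultimately have "f dvd totient n" by (simp only: dvd_mult2)
  then obtain t where t: "coprime n t" "ord n t = f"
    using ex_ord_eq_if_residue_primroot[OF r] \<open>f > 0\<close> by blast
  have "f < p" using dvd_imp_le[OF f] p_gt_1 by simp
  then have "coprime f N"
    using \<open>f > 0\<close> prime_p prime_imp_coprime[of p f]
    by (simp add: N_def coprime_commute nat_dvd_not_less)
  then have "ord p t = f"
    using ord_p_dvd_ord_n[of t] ord_n_dvd_ord_p_mult_N[of t] t(2)
    by (intro dvd_antisym) (simp_all add: coprime_dvd_mult_left_iff)
  moreover have "\<exists>j. [t = q ^ j] (mod n)" if "q \<in> Q" for q
  proof -
    have "coprime n q" using Q[OF that] by (simp add: coprime_n_iff coprime_commute)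
    moreover have "ord n t dvd ord n q" using Q[OF that] ord_p_dvd_ord_n t(2) dvd_trans by blast
    ultimately show ?thesis using residue_primroot_power_if_ord_dvd[OF r n_gt_1 _ t(1)] by blast
  qed
  moreover have "\<not> p dvd t" using t(1) by (simp add: coprime_n_iff coprime_commute)
  ultimately show ?thesis using that t(2) by blast
qed

lemma ex_power_eq_minus_1:
  assumes q: "\<not> p dvd q" and even: "even (ord p q)"
  obtains j where "[q ^ j = n - 1] (mod n)"
proof -
  have "n \<ge> 3" using odd_n n_gt_1 by (cases "n = 2") auto
  have "int n dvd (int n - 1)\<^sup>2 - 1" by (simp add: power2_eq_square algebra_simps)
  then have "[(n - 1)\<^sup>2 = 1] (mod n)"
    using n_pos by (simp add: cong_iff_dvd_diff of_nat_diff flip: cong_int_iff)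
  moreover have "[n - 1 \<noteq> 1] (mod n)" using \<open>n \<ge> 3\<close> by (simp add: cong_def)
  ultimately have two: "ord n (n - 1) = 2" by (simp add: ord_eq_2_iff)
  obtain r where r: "residue_primroot n r" using ex_residue_primroot by blast
  have "coprime n q" using q by (simp add: coprime_n_iff coprime_commute)
  moreover have "coprime n (n - 1)" using two by (metis ord_gt_0_iff zero_less_numeral)
  moreover have "ord n (n - 1) dvd ord n q"
    unfolding two using even ord_p_dvd_ord_n dvd_trans by blast
  ultimately obtain j where "[n - 1 = q ^ j] (mod n)"
    using residue_primroot_power_if_ord_dvd[OF r n_gt_1] by blast
  then show ?thesis using that cong_sym by blast
qed

section \<open>Weil numbers of nonsquare norm\<close>

theorem weil_number_common_order_divisor_odd:
  assumes x: "weil_number m x" and m: "\<not> p dvd m" "\<not> is_square m"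
    and f: "\<And>q. q \<in> prime_factors m \<Longrightarrow> f dvd ord p q"
  shows "odd f"
proof
  assume "even f"
  have "m > 0" using m(2) by (intro gr0I) simp
  have "even (multiplicity q m)" if q: "prime q" for q
  proof (cases "q dvd m")
    case True
    then have "q \<noteq> p" "q \<in> prime_factors m"
      using m(1) q \<open>m > 0\<close> by (auto simp: in_prime_factors_iff)
    moreover from this have "even (ord p q)" using \<open>even f\<close> f dvd_trans by blast
    ultimately obtain j where "[q ^ j = n - 1] (mod n)"
      using ex_power_eq_minus_1 not_p_dvd_prime q by blast
    then show ?thesis using weil_number_even_multiplicity x \<open>m > 0\<close> q \<open>q \<noteq> p\<close> by blast
  qed (simp add: not_dvd_imp_multiplicity_0)
  then show False using m(2) by (simp add: is_nth_power_conv_multiplicity_nat)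
qed

theorem weil_number_common_order_divisor_bound:
  assumes x: "weil_number m x" and m: "\<not> p dvd m" "\<not> is_square m"
    and f: "\<And>q. q \<in> prime_factors m \<Longrightarrow> f dvd ord p q" "m < f"
  shows "real p \<le> ((real f)\<^sup>2 - real m) / (real f - real m)"
proof -
  have "m \<noteq> 0" "m \<noteq> 1" using m(2) by (auto intro: ccontr)
  then have "prime_factors m \<noteq> {}" by (simp add: prime_factorization_empty_iff)
  moreover have "\<not> p dvd q \<and> f dvd ord p q" if "q \<in> prime_factors m" for q
    using that m(1) f(1) not_p_dvd_prime[of q] by (auto simp: in_prime_factors_iff)
  ultimately obtain t where t: "\<not> p dvd t" "ord p t = f" "ord n t = f"
    and decomposition: "\<And>q. q \<in> prime_factors m \<Longrightarrow> \<exists>j. [t = q ^ j] (mod n)"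
    using ex_common_power_of_order[of f "prime_factors m"] f(2) by auto
  obtain e :: int and i where e: "\<bar>e\<bar> = 1" "gal t x = of_int e * \<zeta> ^ i * x"
    using weil_number_gal_eq_root_of_unity_mult[OF x _ m(1) t(1) decomposition] \<open>m \<noteq> 0\<close> by blast
  have "\<not> [t = 1] (mod p)" using ord_eq_Suc_0_iff[of p t] t(2) f(2) \<open>m \<noteq> 0\<close> by simp
  moreover have "[t ^ f = 1] (mod n)" using ord[of t n] t(3) by simp
  moreover have "odd f" using weil_number_common_order_divisor_odd[OF x m f(1)] .
  ultimately obtain y where "weil_number m y" "gal t y = y"
    using weil_number_normalise[OF x _ t(1) _ _ _ e(2,1)] \<open>m \<noteq> 0\<close> by blast
  then have "int f * (int p - int f) \<le> (int p - 1) * int m"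
    using weil_number_orbit_bound[of m y t] m(2) t f(2) by simp
  then have "real_of_int (int f * (int p - int f)) \<le> real_of_int ((int p - 1) * int m)"
    by (simp only: of_int_le_iff)
  then have "real p * (real f - real m) \<le> (real f)\<^sup>2 - real m"
    by (simp add: power2_eq_square algebra_simps)
  then show ?thesis using f(2) by (simp add: pos_le_divide_eq)
qed

end

section \<open>Group-invariant Butson Hadamard matrices\<close>

lemma is_BH_dvd: "is_BH G h H \<Longrightarrow> h dvd k \<Longrightarrow> is_BH G k H"
  by (auto simp: is_BH_def power_mult dvd_def)

lemma is_BH_column_sum:
  fixes G (structure)
  assumes "group G" "is_BH G h H" and l: "l \<in> carrier G"
  shows "(\<Sum>k\<in>carrier G. H k l) = (\<Sum>k\<in>carrier G. H \<one> k)"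
proof -
  interpret group G by fact
  have invariant: "H (x \<otimes> k) (y \<otimes> k) = H x y"
    if "x \<in> carrier G" "y \<in> carrier G" "k \<in> carrier G" for x y k
    using assms(2) that by (simp add: is_BH_def)
  have "bij_betw (\<lambda>k. l \<otimes> inv k) (carrier G) (carrier G)"
  proof (rule bij_betwI[where g = "\<lambda>k. inv k \<otimes> l"])
    show "inv (l \<otimes> inv k) \<otimes> l = k" if "k \<in> carrier G" for k
      using l that by (simp add: inv_mult_group m_assoc)
    show "l \<otimes> inv (inv k \<otimes> l) = k" if "k \<in> carrier G" for k
      using l that by (simp add: inv_mult_group) (simp flip: m_assoc)
  qed (use l in auto)
  then have "(\<Sum>k\<in>carrier G. H \<one> k) = (\<Sum>k\<in>carrier G. H \<one> (l \<otimes> inv k))"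
    by (rule sum.reindex_bij_betw[symmetric])
  also have "\<dots> = (\<Sum>k\<in>carrier G. H k l)"
  proof (intro sum.cong refl)
    fix k assume k: "k \<in> carrier G"
    have "H (\<one> \<otimes> k) (l \<otimes> inv k \<otimes> k) = H \<one> (l \<otimes> inv k)"
      using k l by (intro invariant) auto
    then show "H \<one> (l \<otimes> inv k) = H k l" using k l by (simp add: m_assoc)
  qed
  finally show ?thesis by simp
qed

lemma is_BH_row_sum_norm:
  fixes G (structure)
  assumes "group G" "finite (carrier G)" and H: "is_BH G h H"
  defines "X \<equiv> \<Sum>l\<in>carrier G. H \<one> l"
  shows "X * cnj X = of_nat (order G)"
proof -
  interpret group G by fact
  have "of_nat (order G) = (\<Sum>k\<in>carrier G. \<Sum>l\<in>carrier G. H \<one> l * cnj (H k l))"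
    using H assms(2) by (simp add: is_BH_def)
  also have "\<dots> = (\<Sum>l\<in>carrier G. H \<one> l * cnj (\<Sum>k\<in>carrier G. H k l))"
    by (subst sum.swap) (simp add: sum_distrib_left)
  also have "\<dots> = X * cnj X"
    using is_BH_column_sum[OF assms(1) H] by (simp add: X_def sum_distrib_right)
  finally show ?thesis by simp
qed

lemma (in odd_prime_power_level) ex_weil_number_if_is_BH:
  fixes G (structure)
  assumes "group G" "finite (carrier G)" and H: "is_BH G (2 * n) H"
  shows "\<exists>x. weil_number (order G) x"
proof -
  interpret group G by fact
  have "H \<one> l \<in> R" if "l \<in> carrier G" for l
  proof -
    have "(H \<one> l ^ n)\<^sup>2 = 1" using H that by (simp add: is_BH_def mult.commute flip: power_mult)
    then have "H \<one> l ^ n = 1 \<or> (- H \<one> l) ^ n = 1" using odd_n by (auto simp: power2_eq_1_iff)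
    then show ?thesis
      using root_of_unity_in_R[of "H \<one> l"] root_of_unity_in_R[of "- H \<one> l"]
        int_adjoin_uminus[of "- H \<one> l" \<zeta>] by auto
  qed
  then have "weil_number (order G) (\<Sum>l\<in>carrier G. H \<one> l)"
    using is_BH_row_sum_norm[OF assms] by (simp add: weil_number_def)
  then show ?thesis ..
qed

theorem theorem3p11:
  fixes G :: "('a, 'b) monoid_scheme" and b p c m f :: nat
  assumes "b > 0"
    and "prime p" and "odd p"
    and "comm_group G" and "finite (carrier G)"
    and "order G = p ^ c * m" and "\<not> p dvd m"
    and "\<not> is_square m"
    and "f = Gcd (ord p ` prime_factors m)"
    and "(\<exists>H. is_BH G (p ^ b) H) \<or> (\<exists>H. is_BH G (2 * p ^ b) H)"
  shows "odd f
    \<and> (f \<le> m \<or> real p \<le> ((real f)\<^sup>2 - real m) / (real f - real m))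
    \<and> p \<le> m\<^sup>2 + m + 1"
proof -
  interpret odd_prime_power_level p b using assms(1-3) by unfold_locales
  have "group G" using assms(4) by (rule comm_group.axioms)
  moreover obtain H where "is_BH G (2 * n) H"
    using assms(10) is_BH_dvd[of G "p ^ b" _ "2 * p ^ b"] unfolding n_def by auto
  ultimately obtain y where "weil_number (p ^ c * m) y"
    using ex_weil_number_if_is_BH assms(5,6) by metis
  then obtain x where x: "weil_number m x" by (rule weil_number_divide_p_power)
  have f: "f dvd ord p q" if "q \<in> prime_factors m" for q
    unfolding assms(9) using that by (intro Gcd_dvd) simp
  have "f \<le> m \<or> real p \<le> ((real f)\<^sup>2 - real m) / (real f - real m)"
    using weil_number_common_order_divisor_bound[OF x assms(7,8) f] not_le by blast
  then show ?thesis
    using weil_number_common_order_divisor_odd[OF x assms(7,8) f]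
      weil_number_planar_bound[OF x assms(8)] by blast
qed

end
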